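(* It is PSPACE-hard to distinguish whether a given LCL problem $\mathcal{P}$ with input labels can be solved in $O(1)$ time or needs $\Omega(n)$ time (in the $\mathsf{LOCAL}$ model) on globally oriented path graphs.
   Context: **LOCAL model.** Each node of the $n$-node input graph is a computational entity with a globally unique identifier (a bit string of length $O(\log n)$); initially each node knows its own ID, $n$, the maximum degree, and its input label. In each synchronous round every node exchanges messages of arbitrary size with its neighbors and does arbitrary local computation. All nodes run the same algorithm and each finally outputs a label. Equivalently, a $T(n)$-round algorithm is a function mapping radius-$T(n)$ neighborhoods to output labels. The time complexity of a problem is the minimum worst-case number of rounds as a function of $n$. **LCL problem.** An LCL (locally checkable labeling) problem is given by a finite input label set $\Sigma_{\mathrm{in}}$, a finite output label set $\Sigma_{\mathrm{out}}$, an integer $r$, and a finite set $\mathcal{C}$ of graphs in which every node is labeled with a pair in $\Sigma_{\mathrm{in}}\times\Sigma_{\mathrm{out}}$ and one node is marked as the center. Every node of the input graph receives an input label from $\Sigma_{\mathrm{in}}$ and must output a label from $\Sigma_{\mathrm{out}}$; the output is correct if for each node $v$ the radius-$r$ neighborhood of $v$, with input and output labels (and orientation, on oriented paths), is isomorphic to an element of $\mathcal{C}$ with $v$ corresponding to the center. The problem is given as input to the decision task by this finite description. A globally oriented path is a directed path $p_0,p_1,\dots,p_{n-1}$ in which every node knows which of its neighbors is its predecessor and which is its successor (consistently along the path). *)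

theory Defs
  imports
    Complex_Main
    "HOL-Library.Landau_Symbols"
    "HOL-Computational_Algebra.Polynomial"
begin

section \<open>Turing machines\<close>

text \<open>
  Deterministic multi-tape machines.  States and symbols are initial segments of the naturals.
  State 0 is initial, states 1 (accept) and 2 (reject) are the halting states.
  Symbol 0 is the blank, symbol 1 marks cell 0 of every tape in the initial configuration,
  and 2 and 3 represent the bits.  Tapes are infinite to the right only; moving left from
  cell 0 leaves the head where it is.  Tape 0 is the input tape, the last tape is the
  output tape.  Every tape may be written to.
\<close>

datatype move = Left | Stay | Right

type_synonym tape = "(nat \<Rightarrow> nat) \<times> nat"
type_synonym config = "nat \<times> tape list"

record tm =
  num_tapes :: nat
  num_states :: nat
  num_symbols :: nat
  delta :: "nat \<Rightarrow> nat list \<Rightarrow> nat \<times> (nat \<times> move) list"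

definition valid_tm :: "tm \<Rightarrow> bool" where
  "valid_tm M \<longleftrightarrow>
     num_tapes M \<ge> 1 \<and> num_states M \<ge> 3 \<and> num_symbols M \<ge> 4 \<and>
     (\<forall>q syms. q < num_states M \<and> length syms = num_tapes M \<and> set syms \<subseteq> {..<num_symbols M} \<longrightarrow>
        fst (delta M q syms) < num_states M \<and>
        length (snd (delta M q syms)) = num_tapes M \<and>
        fst ` set (snd (delta M q syms)) \<subseteq> {..<num_symbols M})"

fun read_tape :: "tape \<Rightarrow> nat" where
  "read_tape (cells, pos) = cells pos"

fun act_tape :: "nat \<times> move \<Rightarrow> tape \<Rightarrow> tape" where
  "act_tape (w, d) (cells, pos) =
     (cells(pos := w), case d of Left \<Rightarrow> pos - 1 | Stay \<Rightarrow> pos | Right \<Rightarrow> Suc pos)"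

definition halted :: "config \<Rightarrow> bool" where
  "halted c \<longleftrightarrow> fst c \<in> {1, 2}"

definition step :: "tm \<Rightarrow> config \<Rightarrow> config" where
  "step M c =
     (if halted c then c
      else let (q, acts) = delta M (fst c) (map read_tape (snd c))
           in (q, map2 act_tape acts (snd c)))"

definition bit_symbol :: "bool \<Rightarrow> nat" where
  "bit_symbol b = (if b then 3 else 2)"

definition word_cells :: "bool list \<Rightarrow> nat \<Rightarrow> nat" where
  "word_cells w i =
     (if i = 0 then 1 else if i \<le> length w then bit_symbol (w ! (i - 1)) else 0)"

definition init_config :: "tm \<Rightarrow> bool list \<Rightarrow> config" where
  "init_config M x = (0, (word_cells x, 0) # replicate (num_tapes M - 1) (word_cells [], 0))"

definition run :: "tm \<Rightarrow> bool list \<Rightarrow> nat \<Rightarrow> config" where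
  "run M x t = (step M ^^ t) (init_config M x)"

text \<open>The output is the bit string in cells 1, 2, \<dots> of the last tape, up to the first blank.\<close>

definition has_output :: "config \<Rightarrow> bool list \<Rightarrow> bool" where
  "has_output c y \<longleftrightarrow>
     (\<forall>i<length y. fst (last (snd c)) (Suc i) = bit_symbol (y ! i)) \<and>
     fst (last (snd c)) (Suc (length y)) = 0"

definition poly_time_computable :: "(bool list \<Rightarrow> bool list) \<Rightarrow> bool" where
  "poly_time_computable f \<longleftrightarrow>
     (\<exists>M (p :: nat poly). valid_tm M \<and>
        (\<forall>x. \<exists>t \<le> poly p (length x). halted (run M x t) \<and> has_output (run M x t) (f x)))"

definition PSPACE :: "bool list set set" where
  "PSPACE =
     {L. \<exists>M (p :: nat poly). valid_tm M \<and>
        (\<forall>x. (\<exists>t. halted (run M x t) \<and> (fst (run M x t) = 1 \<longleftrightarrow> x \<in> L)) \<and>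
             (\<forall>t. \<forall>(cells, pos) \<in> set (snd (run M x t)). pos \<le> poly p (length x)))}"

text \<open>
  Hardness, under polynomial-time many-one reductions, of the promise problem of telling
  members of \<open>Y\<close> from members of \<open>N\<close>.
\<close>

definition PSPACE_hard_to_distinguish :: "bool list set \<Rightarrow> bool list set \<Rightarrow> bool" where
  "PSPACE_hard_to_distinguish Y N \<longleftrightarrow>
     (\<forall>L \<in> PSPACE. \<exists>f. poly_time_computable f \<and>
        (\<forall>x. (x \<in> L \<longrightarrow> f x \<in> Y) \<and> (x \<notin> L \<longrightarrow> f x \<in> N)))"


section \<open>LCL problems on globally oriented paths\<close>

text \<open>Node labels are pairs of an input label and an output label; arcs carry the orientation.\<close>

record 'v cgraph =
  nodes :: "'v set"
  arcs :: "('v \<times> 'v) set"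
  label :: "'v \<Rightarrow> nat \<times> nat"
  centre :: 'v

definition cgraph_iso :: "'v cgraph \<Rightarrow> 'w cgraph \<Rightarrow> bool" where
  "cgraph_iso G H \<longleftrightarrow>
     (\<exists>h. bij_betw h (nodes G) (nodes H) \<and>
        (\<forall>u\<in>nodes G. \<forall>v\<in>nodes G. (u, v) \<in> arcs G \<longleftrightarrow> (h u, h v) \<in> arcs H) \<and>
        (\<forall>u\<in>nodes G. label H (h u) = label G u) \<and>
        h (centre G) = centre H)"

text \<open>Finite presentation of a centred graph with nodes \<open>0, \<dots>, length (node_labels g) - 1\<close>.\<close>

record graph_desc =
  node_labels :: "(nat \<times> nat) list"
  arc_list :: "(nat \<times> nat) list"
  centre_node :: nat

definition graph_of :: "graph_desc \<Rightarrow> nat cgraph" where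
  "graph_of g =
     \<lparr>nodes = {..<length (node_labels g)}, arcs = set (arc_list g),
      label = (\<lambda>i. node_labels g ! i), centre = centre_node g\<rparr>"

text \<open>Finite sets are presented by lists; order and repetitions are irrelevant.\<close>

record lcl =
  in_labels :: "nat list"
  out_labels :: "nat list"
  radius :: nat
  allowed :: "graph_desc list"

definition valid_lcl :: "lcl \<Rightarrow> bool" where
  "valid_lcl P \<longleftrightarrow>
     in_labels P \<noteq> [] \<and> out_labels P \<noteq> [] \<and>
     (\<forall>g \<in> set (allowed P).
        centre_node g < length (node_labels g) \<and>
        set (node_labels g) \<subseteq> set (in_labels P) \<times> set (out_labels P) \<and>
        set (arc_list g) \<subseteq> {..<length (node_labels g)} \<times> {..<length (node_labels g)})"

text \<open>
  The path on \<open>n\<close> nodes has nodes \<open>0, \<dots>, n - 1\<close> and arcs from \<open>u\<close> to its successor \<open>Suc u\<close>.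
  The distance of \<open>u\<close> and \<open>v\<close> is at most \<open>r\<close> iff \<open>u \<le> v + r\<close> and \<open>v \<le> u + r\<close>.
\<close>

definition path_nbhd ::
  "nat \<Rightarrow> (nat \<Rightarrow> nat) \<Rightarrow> (nat \<Rightarrow> nat) \<Rightarrow> nat \<Rightarrow> nat \<Rightarrow> nat cgraph" where
  "path_nbhd n inp out r v =
     (let B = {u. u < n \<and> u \<le> v + r \<and> v \<le> u + r} in
      \<lparr>nodes = B, arcs = {(u, w). u \<in> B \<and> w \<in> B \<and> w = Suc u},
       label = (\<lambda>u. (inp u, out u)), centre = v\<rparr>)"

definition correct_output :: "lcl \<Rightarrow> nat \<Rightarrow> (nat \<Rightarrow> nat) \<Rightarrow> (nat \<Rightarrow> nat) \<Rightarrow> bool" where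
  "correct_output P n inp out \<longleftrightarrow>
     (\<forall>v<n. out v \<in> set (out_labels P) \<and>
        (\<exists>g \<in> set (allowed P). cgraph_iso (path_nbhd n inp out (radius P) v) (graph_of g)))"


section \<open>The LOCAL model on globally oriented paths\<close>

text \<open>
  Up to isomorphism, the radius-\<open>t\<close> neighbourhood of \<open>v\<close> is the list of the (identifier, input
  label) pairs of its nodes in path order, together with the index of \<open>v\<close> in that list.
  An algorithm maps \<open>n\<close> and such a view to an output label.  The maximum degree, which nodes
  also know, is a function of \<open>n\<close> on paths.
\<close>

type_synonym view = "(nat \<times> nat) list \<times> nat"
type_synonym local_alg = "nat \<Rightarrow> view \<Rightarrow> nat"

definition local_view ::
  "nat \<Rightarrow> (nat \<Rightarrow> nat) \<Rightarrow> (nat \<Rightarrow> nat) \<Rightarrow> nat \<Rightarrow> nat \<Rightarrow> view" where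
  "local_view n ids inp t v =
     (map (\<lambda>u. (ids u, inp u)) [v - t ..< min n (Suc (v + t))], v - (v - t))"

text \<open>Identifiers of \<open>O(log n)\<close> bits: distinct numbers below \<open>n ^ c\<close>, for a constant \<open>c\<close>.\<close>

definition valid_ids :: "nat \<Rightarrow> nat \<Rightarrow> (nat \<Rightarrow> nat) \<Rightarrow> bool" where
  "valid_ids c n ids \<longleftrightarrow> inj_on ids {..<n} \<and> ids ` {..<n} \<subseteq> {..<n ^ c}"

definition solves_in :: "nat \<Rightarrow> lcl \<Rightarrow> local_alg \<Rightarrow> nat \<Rightarrow> nat \<Rightarrow> bool" where
  "solves_in c P A n t \<longleftrightarrow>
     (\<forall>ids inp. valid_ids c n ids \<and> (\<forall>v<n. inp v \<in> set (in_labels P)) \<longrightarrow>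
        correct_output P n inp (\<lambda>v. A n (local_view n ids inp t v)))"

definition solvable :: "nat \<Rightarrow> lcl \<Rightarrow> bool" where
  "solvable c P \<longleftrightarrow> (\<forall>n\<ge>1. \<exists>t A. solves_in c P A n t)"

text \<open>
  As algorithms are given \<open>n\<close>, optimal algorithms for the individual \<open>n\<close> combine into a single one,
  so the least worst-case number of rounds can be taken separately for each \<open>n\<close>.
  Only meaningful for solvable problems.
\<close>

definition time_complexity :: "nat \<Rightarrow> lcl \<Rightarrow> nat \<Rightarrow> nat" where
  "time_complexity c P n = (LEAST t. \<exists>A. solves_in c P A n t)"


section \<open>LCL problems as bit strings\<close>

text \<open>
  Numbers are written in unary, so that the description is not more succinct than an explicit
  listing of the label sets and of the allowed neighbourhoods.
\<close>

definition enc_nat :: "nat \<Rightarrow> bool list" where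
  "enc_nat k = replicate k True @ [False]"

definition enc_pair :: "nat \<times> nat \<Rightarrow> bool list" where
  "enc_pair p = enc_nat (fst p) @ enc_nat (snd p)"

definition enc_list :: "('a \<Rightarrow> bool list) \<Rightarrow> 'a list \<Rightarrow> bool list" where
  "enc_list e xs = concat (map (\<lambda>x. True # e x) xs) @ [False]"

definition enc_graph :: "graph_desc \<Rightarrow> bool list" where
  "enc_graph g =
     enc_list enc_pair (node_labels g) @ enc_list enc_pair (arc_list g) @ enc_nat (centre_node g)"

definition enc_lcl :: "lcl \<Rightarrow> bool list" where
  "enc_lcl P =
     enc_list enc_nat (in_labels P) @ enc_list enc_nat (out_labels P) @
     enc_nat (radius P) @ enc_list enc_graph (allowed P)"

definition constant_time_lcls :: "nat \<Rightarrow> bool list set" where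
  "constant_time_lcls c =
     {enc_lcl P | P. valid_lcl P \<and> solvable c P \<and>
        (\<lambda>n. real (time_complexity c P n)) \<in> O(\<lambda>_. 1)}"

definition linear_time_lcls :: "nat \<Rightarrow> bool list set" where
  "linear_time_lcls c =
     {enc_lcl P | P. valid_lcl P \<and> solvable c P \<and>
        (\<lambda>n. real (time_complexity c P n)) \<in> \<Omega>(\<lambda>n. real n)}"


subsection \<open>The encoding is injective, and the two sets are disjoint\<close>

definition prefix_code :: "('a \<Rightarrow> bool list) \<Rightarrow> bool" where
  "prefix_code e \<longleftrightarrow> (\<forall>x y a b. e x @ a = e y @ b \<longrightarrow> x = y \<and> a = b)"

lemma prefix_codeD: "prefix_code e \<Longrightarrow> e x @ a = e y @ b \<Longrightarrow> x = y \<and> a = b"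
  unfolding prefix_code_def by blast

lemma prefix_code_enc_nat: "prefix_code enc_nat"
proof -
  have "x = y \<and> a = b" if "enc_nat x @ a = enc_nat y @ b" for x y a b
    using that
  proof (induction x arbitrary: y)
    case 0
    then show ?case by (cases y) (auto simp: enc_nat_def)
  next
    case (Suc x)
    then show ?case by (cases y) (auto simp: enc_nat_def)
  qed
  then show ?thesis unfolding prefix_code_def by blast
qed

lemma prefix_code_enc_pair: "prefix_code enc_pair"
proof -
  have "p = q \<and> a = b" if "enc_pair p @ a = enc_pair q @ b" for p q a b
  proof -
    from that have eq: "enc_nat (fst p) @ (enc_nat (snd p) @ a) = enc_nat (fst q) @ (enc_nat (snd q) @ b)"
      by (simp add: enc_pair_def)
    note 1 = prefix_codeD[OF prefix_code_enc_nat eq]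
    note 2 = prefix_codeD[OF prefix_code_enc_nat conjunct2[OF 1]]
    from 1 2 show ?thesis by (simp add: prod_eq_iff)
  qed
  then show ?thesis unfolding prefix_code_def by blast
qed

lemma prefix_code_enc_list:
  assumes "prefix_code e"
  shows "prefix_code (enc_list e)"
proof -
  have "xs = ys \<and> a = b" if "enc_list e xs @ a = enc_list e ys @ b" for xs ys a b
    using that
  proof (induction xs arbitrary: ys)
    case Nil
    then show ?case by (cases ys) (auto simp: enc_list_def)
  next
    case (Cons x xs)
    then obtain y ys' where ys: "ys = y # ys'"
      by (cases ys) (auto simp: enc_list_def)
    with Cons.prems have "e x @ (enc_list e xs @ a) = e y @ (enc_list e ys' @ b)"
      by (simp add: enc_list_def)
    from prefix_codeD[OF assms this] Cons.IH ys show ?case by blast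
  qed
  then show ?thesis unfolding prefix_code_def by blast
qed

lemma prefix_code_enc_graph: "prefix_code enc_graph"
proof -
  note L = prefix_codeD[OF prefix_code_enc_list[OF prefix_code_enc_pair]]
  have "g = h \<and> a = b" if "enc_graph g @ a = enc_graph h @ b" for g h :: graph_desc and a b
  proof -
    from that have eq:
      "enc_list enc_pair (node_labels g) @ (enc_list enc_pair (arc_list g) @ enc_nat (centre_node g) @ a) =
       enc_list enc_pair (node_labels h) @ (enc_list enc_pair (arc_list h) @ enc_nat (centre_node h) @ b)"
      by (simp add: enc_graph_def)
    note 1 = L[OF eq]
    note 2 = L[OF conjunct2[OF 1]]
    note 3 = prefix_codeD[OF prefix_code_enc_nat conjunct2[OF 2]]
    from 1 2 3 show ?thesis by simp
  qed
  then show ?thesis unfolding prefix_code_def by blast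
qed

lemma inj_enc_lcl: "inj enc_lcl"
proof (rule injI)
  fix P Q :: lcl assume "enc_lcl P = enc_lcl Q"
  then have eq: "enc_list enc_nat (in_labels P) @ (enc_list enc_nat (out_labels P) @
        enc_nat (radius P) @ enc_list enc_graph (allowed P) @ []) =
      enc_list enc_nat (in_labels Q) @ (enc_list enc_nat (out_labels Q) @
        enc_nat (radius Q) @ enc_list enc_graph (allowed Q) @ [])"
    by (simp add: enc_lcl_def)
  note N = prefix_codeD[OF prefix_code_enc_list[OF prefix_code_enc_nat]]
  note 1 = N[OF eq]
  note 2 = N[OF conjunct2[OF 1]]
  note 3 = prefix_codeD[OF prefix_code_enc_nat conjunct2[OF 2]]
  note 4 = prefix_codeD[OF prefix_code_enc_list[OF prefix_code_enc_graph] conjunct2[OF 3]]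
  from 1 2 3 4 show "P = Q" by simp
qed

lemma constant_linear_disjoint: "constant_time_lcls c \<inter> linear_time_lcls c = {}"
proof -
  have False
    if O: "f \<in> O(\<lambda>_. 1)" and Om: "f \<in> \<Omega>(\<lambda>n. real n)" for f :: "nat \<Rightarrow> real"
  proof -
    have "(\<lambda>n. real n) \<in> O(f)"
      using Om by (simp add: bigomega_iff_bigo)
    then have "(\<lambda>n. real n) \<in> O(\<lambda>_. 1)"
      using O landau_o.big_trans by blast
    then obtain K where "eventually (\<lambda>n. norm (real n) \<le> K * norm (1::real)) at_top"
      by (auto elim: landau_o.bigE)
    then have "eventually (\<lambda>n. real n \<le> K) at_top" by simp
    moreover have "eventually (\<lambda>n. K < real n) at_top"
      using filterlim_real_sequentially by (auto simp: filterlim_at_top_dense)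
    ultimately have "eventually (\<lambda>n::nat. False) at_top"
      by eventually_elim simp
    then show False by simp
  qed
  then show ?thesis
    using inj_enc_lcl by (auto simp: constant_time_lcls_def linear_time_lcls_def inj_eq)
qed

end

theory Submission
  imports Defs
begin

text \<open>
  Inputs describe, in blocks of \<open>B\<close> letters, the successive configurations of a machine for the given
  language, preceded by one letter that carries a secret bit.  The nodes of the path have to propagate
  the secret from the first node, and are released from this duty only behind a place where the input
  violates the rules of the computation.  Such a violation involves letters at distance \<open>B\<close>; it is
  exhibited by output labels that name the offending letter and count down to its position, which is
  checked with radius 1.  An accepting state is itself a violation.  So if the machine accepts, every
  input has an error within a bounded prefix and constant time suffices; if it rejects, the halting
  configuration can be repeated forever, no error can be exhibited, and the last nodes must learn the
  secret from the other end of the path.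

  The reduction is computed by a machine whose tapes, apart from the output tape, are never written to:
  their heads serve as counters.  It is given as a structured counter program, and the control states
  of the compiled machine are the continuations of the program.
\<close>

section \<open>Counter programs\<close>

text \<open>The description must be polynomial in the input, which rules out radius
  \<open>B\<close>: neighbourhoods would then number at least K^B. With radius 1 the letter
  \<open>B\<close> steps ahead is out of sight, so the reporting node guesses it, and one of K * (B
  + 1) labels carries the guess to its place. A dishonest guess is refuted where its countdown ends,
  unless the path ends earlier; hence the secret is forced only on nodes at least \<open>B\<close> +
  1 steps before the last one, which still gives a linear bound. The alphabet size \<open>K\<close>
  and the local rule depend only on the machine for the language; the input word enters through
  \<open>B\<close> and the first block alone. So every enumeration of letters can be fixed program
  text, and genuine loops are needed only for countdown lengths, nested at most twice. The secret
  sits in front of the first block because changing it must not make the word invalid: the rule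
  meets that letter only as the left neighbour of a letter marked leftmost, and such a letter
  ignores its left neighbour.\<close>

datatype com =
    Skip
  | Inc nat
  | Dec nat
  | Emit bool
  | Seq com com
  | IfEq nat nat com com
  | WhileNe nat nat com

definition tape_word :: "bool list \<Rightarrow> nat \<Rightarrow> bool list" where
  "tape_word x i = (if i = 0 then x else [])"

text \<open>Counter tapes keep their initial contents, so the symbol under a head is a function of
  the head position alone and no tape contents occur in the semantics.\<close>

definition tape_sym :: "bool list \<Rightarrow> nat \<Rightarrow> nat \<Rightarrow> nat" where
  "tape_sym x i = word_cells (tape_word x i)"

text \<open>The time is exact: each test and each \<open>Seq\<close> costs one step, as it does for
  the stack machine and the compiled machine. \<open>Dec\<close> truncates at 0 like a head moving
  left from cell 0.\<close>

inductive exec ::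
  "bool list \<Rightarrow> com \<Rightarrow> (nat \<Rightarrow> nat) \<Rightarrow> bool list \<Rightarrow> nat \<Rightarrow> (nat \<Rightarrow> nat) \<Rightarrow> bool list \<Rightarrow> bool"
  for x :: "bool list" where
  exec_Skip: "exec x Skip h y 1 h y"
| exec_Inc: "exec x (Inc i) h y 1 (h(i := Suc (h i))) y"
| exec_Dec: "exec x (Dec i) h y 1 (h(i := h i - 1)) y"
| exec_Emit: "exec x (Emit b) h y 1 h (y @ [b])"
| exec_Seq: "exec x c h y t h' y' \<Longrightarrow> exec x d h' y' t' h'' y'' \<Longrightarrow>
    exec x (Seq c d) h y (Suc (t + t')) h'' y''"
| exec_If_eq: "tape_sym x i (h i) = a \<Longrightarrow> exec x c h y t h' y' \<Longrightarrow> exec x (IfEq i a c d) h y (Suc t) h' y'"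
| exec_If_ne: "tape_sym x i (h i) \<noteq> a \<Longrightarrow> exec x d h y t h' y' \<Longrightarrow> exec x (IfEq i a c d) h y (Suc t) h' y'"
| exec_While_eq: "tape_sym x i (h i) = a \<Longrightarrow> exec x (WhileNe i a c) h y 1 h y"
| exec_While_ne: "tape_sym x i (h i) \<noteq> a \<Longrightarrow> exec x c h y t h' y' \<Longrightarrow>
    exec x (WhileNe i a c) h' y' t' h'' y'' \<Longrightarrow>
    exec x (WhileNe i a c) h y (Suc (t + t')) h'' y''"

text \<open>The next stack depends on the scanned symbols only, not on the head positions; this is
  what makes a stack usable as a control state.\<close>

fun next_stack :: "com list \<Rightarrow> (nat \<Rightarrow> nat) \<Rightarrow> com list" where
  "next_stack [] s = []"
| "next_stack (Seq c d # st) s = c # d # st"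
| "next_stack (IfEq i a c d # st) s = (if s i = a then c # st else d # st)"
| "next_stack (WhileNe i a c # st) s = (if s i = a then st else c # WhileNe i a c # st)"
| "next_stack (_ # st) s = st"

fun next_heads :: "com list \<Rightarrow> (nat \<Rightarrow> nat) \<Rightarrow> (nat \<Rightarrow> nat)" where
  "next_heads (Inc i # st) h = h(i := Suc (h i))"
| "next_heads (Dec i # st) h = h(i := h i - 1)"
| "next_heads st h = h"

fun next_output :: "com list \<Rightarrow> bool list \<Rightarrow> bool list" where
  "next_output (Emit b # st) y = y @ [b]"
| "next_output st y = y"

fun stack_step :: "bool list \<Rightarrow> com list \<times> (nat \<Rightarrow> nat) \<times> bool list \<Rightarrow>
    com list \<times> (nat \<Rightarrow> nat) \<times> bool list" where
  "stack_step x (st, h, y) =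
     (next_stack st (\<lambda>i. tape_sym x i (h i)), next_heads st h, next_output st y)"

lemma exec_stack_step:
  "exec x c h y t h' y' \<Longrightarrow> (stack_step x ^^ t) (c # st, h, y) = (st, h', y')"
proof (induction arbitrary: st rule: exec.induct)
  case (exec_Seq c h y t h' y' d t' h'' y'')
  then show ?case
    by (simp add: funpow_swap1 funpow_add add.commute[of t])
next
  case (exec_While_ne i h a c y t h' y' t' h'' y'')
  then show ?case
    by (simp add: funpow_swap1 funpow_add add.commute[of t])
qed (simp_all add: funpow_swap1)

text \<open>Covers all stacks met while \<open>c\<close> is executed on top of \<open>st\<close>.
  The set stays finite because a loop puts itself back under its body instead of being
  unfolded.\<close>

fun conts :: "com \<Rightarrow> com list \<Rightarrow> com list set" where
  "conts (Seq c d) st = {Seq c d # st} \<union> conts c (d # st) \<union> conts d st"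
| "conts (IfEq i a c d) st = {IfEq i a c d # st} \<union> conts c st \<union> conts d st"
| "conts (WhileNe i a c) st = {WhileNe i a c # st} \<union> conts c (WhileNe i a c # st)"
| "conts c st = {c # st}"

lemma finite_conts: "finite (conts c st)"
  by (induction c st rule: conts.induct) auto

lemma conts_self: "c # st \<in> conts c st"
  by (cases c) auto

lemma next_stack_conts: "s \<in> conts c st \<Longrightarrow> next_stack s f \<in> insert st (conts c st)"
proof (induction c st rule: conts.induct)
  case (1 c d st)
  then show ?case using conts_self[of c "d # st"] conts_self[of d st] by auto
next
  case (2 i a c d st)
  then show ?case using conts_self[of c "st"] conts_self[of d st] by auto
next
  case (3 i a c st)
  then show ?case using conts_self[of c "WhileNe i a c # st"] by (auto split: if_splits)
qed auto

fun wf_com :: "nat \<Rightarrow> com \<Rightarrow> bool" where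
  "wf_com m (Inc i) \<longleftrightarrow> i < m"
| "wf_com m (Dec i) \<longleftrightarrow> i < m"
| "wf_com m (Seq c d) \<longleftrightarrow> wf_com m c \<and> wf_com m d"
| "wf_com m (IfEq i a c d) \<longleftrightarrow> i < m \<and> wf_com m c \<and> wf_com m d"
| "wf_com m (WhileNe i a c) \<longleftrightarrow> i < m \<and> wf_com m c"
| "wf_com m _ \<longleftrightarrow> True"

lemma conts_wf:
  "s \<in> conts c st \<Longrightarrow> wf_com m c \<Longrightarrow> list_all (wf_com m) st \<Longrightarrow> list_all (wf_com m) s"
  by (induction c st rule: conts.induct) auto

section \<open>Compilation of counter programs to Turing machines\<close>

fun tape_action :: "nat \<Rightarrow> com list \<Rightarrow> nat \<Rightarrow> nat \<Rightarrow> nat \<times> move" where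
  "tape_action m (Inc j # st) i a = (a, if i = j then Right else Stay)"
| "tape_action m (Dec j # st) i a = (a, if i = j then Left else Stay)"
| "tape_action m (Emit b # st) i a = (if i = m then (bit_symbol b, Right) else (a, Stay))"
| "tape_action m st i a = (a, Stay)"

lemma bit_symbol_less [simp]: "bit_symbol b < 4"
  by (simp add: bit_symbol_def)

lemma fst_tape_action: "a < 4 \<Longrightarrow> fst (tape_action m st i a) < 4"
  by (induction m st i a rule: tape_action.induct) auto

text \<open>The control states are the reachable continuation stacks.  State 0 only moves the head
  of the output tape to cell 1.\<close>

definition com_tm :: "nat \<Rightarrow> com \<Rightarrow> (com list \<Rightarrow> nat) \<Rightarrow> tm" where
  "com_tm m c code =
     (let Q = insert [] (conts c []) in
      \<lparr>num_tapes = Suc m, num_states = card Q + 3, num_symbols = 4,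
       delta = (\<lambda>q syms.
         if q \<in> code ` Q then
           let st = inv_into Q code q
           in (code (next_stack st (\<lambda>i. syms ! i)), map (\<lambda>i. tape_action m st i (syms ! i)) [0..<Suc m])
         else (code [c], map (\<lambda>i. (syms ! i, if i = m then Right else Stay)) [0..<Suc m]))\<rparr>)"

definition com_tapes :: "nat \<Rightarrow> bool list \<Rightarrow> (nat \<Rightarrow> nat) \<Rightarrow> bool list \<Rightarrow> tape list" where
  "com_tapes m x h y =
     map (\<lambda>i. (word_cells (tape_word x i), h i)) [0..<m] @ [(word_cells y, Suc (length y))]"

lemma word_cells_append:
  "(word_cells y)(Suc (length y) := bit_symbol b) = word_cells (y @ [b])"
  by (auto simp: fun_eq_iff word_cells_def nth_append)

lemma com_tapes_nth: "i < m \<Longrightarrow> com_tapes m x h y ! i = (word_cells (tape_word x i), h i)"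
  by (simp add: com_tapes_def nth_append)

lemma com_tapes_last: "com_tapes m x h y ! m = (word_cells y, Suc (length y))"
  by (simp add: com_tapes_def nth_append)

lemma length_com_tapes [simp]: "length (com_tapes m x h y) = Suc m"
  by (simp add: com_tapes_def)

lemma act_com_tapes:
  assumes "list_all (wf_com m) st" "\<And>i. i \<le> m \<Longrightarrow> syms ! i = read_tape (com_tapes m x h y ! i)"
  shows "map2 act_tape (map (\<lambda>i. tape_action m st i (syms ! i)) [0..<Suc m]) (com_tapes m x h y) =
     com_tapes m x (next_heads st h) (next_output st y)"
proof (rule nth_equalityI)
  fix i assume "i < length (map2 act_tape (map (\<lambda>i. tape_action m st i (syms ! i)) [0..<Suc m]) (com_tapes m x h y))"
  then have i: "i \<le> m" by simp
  have upt: "[0..<Suc m] ! i = i" using i by (simp del: upt_Suc)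
  show "map2 act_tape (map (\<lambda>i. tape_action m st i (syms ! i)) [0..<Suc m]) (com_tapes m x h y) ! i =
     com_tapes m x (next_heads st h) (next_output st y) ! i"
  proof (cases "i = m")
    case True
    show ?thesis
    proof (cases st)
      case Nil
      then show ?thesis using i upt assms True by (simp add: com_tapes_last del: upt_Suc)
    next
      case (Cons c st')
      then show ?thesis using i upt assms True
        by (cases c) (auto simp: com_tapes_last word_cells_append simp del: upt_Suc)
    qed
  next
    case False
    with i have i: "i < m" by simp
    show ?thesis
    proof (cases st)
      case Nil
      then show ?thesis using i upt assms by (simp add: com_tapes_nth del: upt_Suc)
    next
      case (Cons c st')
      then show ?thesis using i upt assms 
        by (cases c) (auto simp: com_tapes_nth simp del: upt_Suc)
    qed
  qed
qed simp

text \<open>A well-formed program never tests tape \<open>m\<close>, the output tape, whose contents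
  \<open>tape_sym\<close> does not describe.\<close>

lemma next_stack_cong:
  "list_all (wf_com m) st \<Longrightarrow> (\<And>i. i < m \<Longrightarrow> s i = s' i) \<Longrightarrow> next_stack st s = next_stack st s'"
  by (induction st s rule: next_stack.induct) auto

theorem poly_time_computable_exec:
  assumes wf: "wf_com m c" and m: "m \<ge> 1"
    and run: "\<And>x. \<exists>t h. t \<le> poly p (length x) \<and> exec x c (\<lambda>_. 0) [] t h (f x)"
  shows "poly_time_computable f"
proof -
  define Q where "Q = insert [] (conts c [])"
  have finQ: "finite Q" by (simp add: Q_def finite_conts)
  obtain g :: "com list \<Rightarrow> nat" where g: "bij_betw g Q {0..<card Q}"
    using ex_bij_betw_finite_nat[OF finQ] by blast
  \<comment> \<open>The empty stack becomes the accepting state 1. The offset 3 keeps 0 free for the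
    initial state, so that its only transition is the default branch of \<open>delta\<close>, and
    avoids the halting state 2.\<close>
  define code where "code st = (if st = [] then 1 else g st + 3)" for st
  have inj: "inj_on code Q"
    using bij_betw_imp_inj_on[OF g] by (auto simp: inj_on_def code_def)
  have code_less: "code st < card Q + 3" if "st \<in> Q" for st
    using bij_betwE[OF g] that by (auto simp: code_def)
  have nz: "0 \<notin> code ` Q" by (auto simp: code_def)
  have closed: "next_stack st s \<in> Q" if "st \<in> Q" for st s
    using that next_stack_conts[of st c "[]" s] by (auto simp: Q_def)
  have cQ: "[c] \<in> Q" by (simp add: Q_def conts_self)
  have wfQ: "list_all (wf_com m) st" if "st \<in> Q" for st
    using that conts_wf[of st c "[]" m] wf by (auto simp: Q_def)
  define M where "M = com_tm m c code"
  have M: "num_tapes M = Suc m" "num_states M = card Q + 3" "num_symbols M = 4"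
    by (simp_all add: M_def com_tm_def Q_def Let_def)
  have delta_code: "delta M (code st) syms =
      (code (next_stack st (\<lambda>i. syms ! i)), map (\<lambda>i. tape_action m st i (syms ! i)) [0..<Suc m])"
    if "st \<in> Q" for st syms
    using that inj by (simp add: M_def com_tm_def Let_def Q_def[symmetric] del: upt_Suc)
  have delta_other: "delta M q syms =
      (code [c], map (\<lambda>i. (syms ! i, if i = m then Right else Stay)) [0..<Suc m])"
    if "q \<notin> code ` Q" for q syms
    using that by (simp add: M_def com_tm_def Let_def Q_def[symmetric] del: upt_Suc)
  have valid: "valid_tm M"
    unfolding valid_tm_def M
  proof (intro conjI allI impI)
    fix q and syms :: "nat list"
    assume *: "q < card Q + 3 \<and> length syms = Suc m \<and> set syms \<subseteq> {..<4}"
    then have syms: "syms ! i < 4" if "i < Suc m" for i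
      using that nth_mem[of i syms] by (auto simp: subset_iff)
    show "fst (delta M q syms) < card Q + 3"
      using delta_code delta_other cQ closed code_less by (cases "q \<in> code ` Q") auto
    show "length (snd (delta M q syms)) = Suc m"
      using delta_code delta_other by (cases "q \<in> code ` Q") auto
    show "fst ` set (snd (delta M q syms)) \<subseteq> {..<4}"
      using delta_code delta_other fst_tape_action[OF syms] syms
      by (cases "q \<in> code ` Q") (auto simp del: upt_Suc, metis fst_conv)
  qed (use m in auto)
  define conf where "conf x s = (code (fst s), com_tapes m x (fst (snd s)) (snd (snd s)))" for x s
  have halt: "halted (conf x (st, h, y)) \<longleftrightarrow> st = []" for x st h y
    by (auto simp: halted_def conf_def code_def)
  have step_conf: "step M (conf x (st, h, y)) = conf x (stack_step x (st, h, y))"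
    if "st \<in> Q" for x st h y
  proof (cases "st = []")
    case True
    then show ?thesis by (simp add: step_def halt)
  next
    case False
    let ?syms = "map read_tape (com_tapes m x h y)"
    have syms: "?syms ! i = read_tape (com_tapes m x h y ! i)" if "i \<le> m" for i
      using that by simp
    have "step M (conf x (st, h, y)) =
      (code (next_stack st (\<lambda>i. ?syms ! i)),
       map2 act_tape (map (\<lambda>i. tape_action m st i (?syms ! i)) [0..<Suc m]) (com_tapes m x h y))"
      using False halt[of x st h y] delta_code[OF that, of ?syms]
      by (simp add: step_def conf_def del: upt_Suc)
    also have "\<dots> = conf x (stack_step x (st, h, y))"
      using act_com_tapes[OF wfQ[OF that] syms]
        next_stack_cong[OF wfQ[OF that], of "\<lambda>i. ?syms ! i" "\<lambda>i. tape_sym x i (h i)"]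
      by (simp add: conf_def com_tapes_nth tape_sym_def del: upt_Suc)
    finally show ?thesis .
  qed
  have steps_conf: "(step M ^^ t) (conf x s) = conf x ((stack_step x ^^ t) s) \<and>
      fst ((stack_step x ^^ t) s) \<in> Q" if "fst s \<in> Q" for x s t
  proof (induction t)
    case (Suc t)
    then show ?case
      using closed by (cases "(stack_step x ^^ t) s") (auto simp: step_conf)
  qed (use that in simp)
  have init: "step M (init_config M x) = conf x ([c], \<lambda>_. 0, [])" for x
  proof -
    let ?ts = "snd (init_config M x)"
    have ts: "?ts ! i = (word_cells (tape_word x i), 0)" if "i \<le> m" for i
      using that m by (auto simp: init_config_def M nth_Cons tape_word_def split: nat.splits)
    have len: "length ?ts = Suc m" by (simp add: init_config_def M)
    have "step M (init_config M x) = (code [c],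
      map2 act_tape (map (\<lambda>i. (map read_tape ?ts ! i, if i = m then Right else Stay)) [0..<Suc m]) ?ts)"
      using delta_other[OF nz]
      by (simp add: step_def halted_def init_config_def del: upt_Suc)
    also have "map2 act_tape (map (\<lambda>i. (map read_tape ?ts ! i, if i = m then Right else Stay)) [0..<Suc m]) ?ts
       = com_tapes m x (\<lambda>_. 0) []"
    proof (rule nth_equalityI)
      fix i assume "i < length (map2 act_tape (map (\<lambda>i. (map read_tape ?ts ! i, if i = m then Right else Stay)) [0..<Suc m]) ?ts)"
      then have i: "i \<le> m" using len by simp
      have upt: "[0..<Suc m] ! i = i" using i by (simp del: upt_Suc)
      show "map2 act_tape (map (\<lambda>i. (map read_tape ?ts ! i, if i = m then Right else Stay)) [0..<Suc m]) ?ts ! i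
          = com_tapes m x (\<lambda>_. 0) [] ! i"
        using i len upt m ts[OF i] by (cases "i = m")
          (auto simp: com_tapes_nth com_tapes_last tape_word_def simp del: upt_Suc)
    qed (use len in simp)
    finally show ?thesis by (simp add: conf_def)
  qed
  \<comment> \<open>The additional step is the one from state 0, which moves the output head off the
    marker.\<close>
  have "\<exists>t\<le>poly (p + 1) (length x). halted (run M x t) \<and> has_output (run M x t) (f x)" for x
  proof -
    obtain t h where t: "t \<le> poly p (length x)" and ex: "exec x c (\<lambda>_. 0) [] t h (f x)"
      using run by blast
    have "run M x (Suc t) = (step M ^^ t) (conf x ([c], \<lambda>_. 0, []))"
      by (simp add: run_def funpow_swap1 init)
    also have "\<dots> = conf x ([], h, f x)"
      using steps_conf[of "([c], \<lambda>_. 0, [])" t x] exec_stack_step[OF ex, of "[]"] cQ by simp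
    finally have r: "run M x (Suc t) = conf x ([], h, f x)" .
    have "halted (run M x (Suc t))" using r halt by simp
    moreover have "has_output (run M x (Suc t)) (f x)"
      by (simp add: r conf_def has_output_def com_tapes_def word_cells_def)
    moreover have "Suc t \<le> poly (p + 1) (length x)" using t by simp
    ultimately show ?thesis by blast
  qed
  then show ?thesis using valid unfolding poly_time_computable_def by blast
qed


section \<open>Programs that generate text\<close>

definition poly_bounded :: "(nat \<Rightarrow> nat) \<Rightarrow> bool" where
  "poly_bounded f \<longleftrightarrow> (\<exists>q :: nat poly. \<forall>n. f n \<le> poly q n)"

lemma poly_nat_mono: "a \<le> b \<Longrightarrow> poly q a \<le> poly (q :: nat poly) b"
  by (induction q) (auto intro: add_mono mult_mono)

lemma poly_bounded_poly: "poly_bounded (poly q)"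
  unfolding poly_bounded_def by blast

lemma poly_bounded_const: "poly_bounded (\<lambda>_. k)"
  unfolding poly_bounded_def by (rule exI[of _ "[:k:]"]) simp

lemma poly_bounded_id: "poly_bounded (\<lambda>n. n)"
  unfolding poly_bounded_def by (rule exI[of _ "[:0, 1:]"]) simp

lemma poly_bounded_add:
  assumes "poly_bounded f" "poly_bounded g"
  shows "poly_bounded (\<lambda>n. f n + g n)"
proof -
  obtain p q where "\<forall>n. f n \<le> poly p n" "\<forall>n. g n \<le> poly q n"
    using assms unfolding poly_bounded_def by blast
  then show ?thesis unfolding poly_bounded_def
    by (intro exI[of _ "p + q"]) (simp add: add_mono)
qed

lemma poly_bounded_mult:
  assumes "poly_bounded f" "poly_bounded g"
  shows "poly_bounded (\<lambda>n. f n * g n)"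
proof -
  obtain p q where "\<forall>n. f n \<le> poly p n" "\<forall>n. g n \<le> poly q n"
    using assms unfolding poly_bounded_def by blast
  then show ?thesis unfolding poly_bounded_def
    by (intro exI[of _ "p * q"]) (simp add: mult_mono)
qed

lemma poly_bounded_Suc: "poly_bounded f \<Longrightarrow> poly_bounded (\<lambda>n. Suc (f n))"
  using poly_bounded_add[OF poly_bounded_const[of 1], of f] by simp

lemma poly_bounded_compose:
  assumes "poly_bounded f" "poly_bounded g"
  shows "poly_bounded (\<lambda>n. f (g n))"
proof -
  obtain p q where p: "\<forall>n. f n \<le> poly p n" and q: "\<forall>n. g n \<le> poly q n"
    using assms unfolding poly_bounded_def by blast
  have "f (g n) \<le> poly (pcompose p q) n" for n
    using p[rule_format, of "g n"] poly_nat_mono[OF q[rule_format, of n], of p]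
    by (simp add: poly_pcompose)
  then show ?thesis unfolding poly_bounded_def by blast
qed

lemmas poly_bounded_intros = poly_bounded_poly poly_bounded_const poly_bounded_id
  poly_bounded_add poly_bounded_mult poly_bounded_Suc

text \<open>An upper bound in place of the exact time lets the branches of a test and the rounds of
  a loop share one bound.\<close>

definition execs ::
  "bool list \<Rightarrow> com \<Rightarrow> (nat \<Rightarrow> nat) \<Rightarrow> bool list \<Rightarrow> nat \<Rightarrow> (nat \<Rightarrow> nat) \<Rightarrow> bool list \<Rightarrow> bool" where
  "execs x c h y T h' y' \<longleftrightarrow> (\<exists>t\<le>T. exec x c h y t h' y')"

lemma execs_mono: "execs x c h y T h' y' \<Longrightarrow> T \<le> T' \<Longrightarrow> execs x c h y T' h' y'"
  unfolding execs_def using le_trans by blast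

lemma execs_Skip: "execs x Skip h y 1 h y"
  and execs_Inc: "execs x (Inc i) h y 1 (h(i := Suc (h i))) y"
  and execs_Dec: "execs x (Dec i) h y 1 (h(i := h i - 1)) y"
  and execs_Emit: "execs x (Emit b) h y 1 h (y @ [b])"
  unfolding execs_def using exec.intros(1-4) by blast+

lemma execs_Seq:
  assumes "execs x c h y T h' y'" "execs x d h' y' T' h'' y''"
  shows "execs x (Seq c d) h y (Suc (T + T')) h'' y''"
proof -
  obtain t t' where "t \<le> T" "exec x c h y t h' y'" "t' \<le> T'" "exec x d h' y' t' h'' y''"
    using assms unfolding execs_def by blast
  then show ?thesis
    unfolding execs_def by (intro exI[of _ "Suc (t + t')"] conjI exec_Seq) auto
qed

lemma execs_If:
  assumes "tape_sym x i (h i) = a \<Longrightarrow> execs x c h y T h' y'"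
    and "tape_sym x i (h i) \<noteq> a \<Longrightarrow> execs x d h y T h' y'"
  shows "execs x (IfEq i a c d) h y (Suc T) h' y'"
proof (cases "tape_sym x i (h i) = a")
  case True
  with assms(1) obtain t where "t \<le> T" "exec x c h y t h' y'" unfolding execs_def by blast
  with True show ?thesis unfolding execs_def by (intro exI[of _ "Suc t"] conjI exec_If_eq) auto
next
  case False
  with assms(2) obtain t where "t \<le> T" "exec x d h y t h' y'" unfolding execs_def by blast
  with False show ?thesis unfolding execs_def by (intro exI[of _ "Suc t"] conjI exec_If_ne) auto
qed

text \<open>\<open>H j\<close> and \<open>Y j\<close> are the heads and the output before round
  \<open>j\<close>; giving the whole trajectory replaces an invariant and a termination measure at
  once.\<close>

lemma execs_While:
  assumes ne: "\<And>j. j < n \<Longrightarrow> tape_sym x i (H j i) \<noteq> a" and eq: "tape_sym x i (H n i) = a"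
    and body: "\<And>j. j < n \<Longrightarrow> execs x c (H j) (Y j) T (H (Suc j)) (Y (Suc j))"
    and "h = H 0" "h' = H n" "y = Y 0" "y' = Y n"
  shows "execs x (WhileNe i a c) h y (Suc (n * Suc T)) h' y'"
proof -
  have "execs x (WhileNe i a c) (H j) (Y j) (Suc ((n - j) * Suc T)) (H n) (Y n)" if "j \<le> n" for j
    using that
  proof (induction rule: inc_induct)
    case base
    show ?case using exec_While_eq[of x i "H n" a, OF eq] by (auto simp: execs_def)
  next
    case (step j)
    have "execs x (WhileNe i a c) (H j) (Y j) (Suc (T + Suc ((n - Suc j) * Suc T))) (H n) (Y n)"
    proof -
      have j: "j < n" using step by simp
      obtain t t' where t: "t \<le> T" "exec x c (H j) (Y j) t (H (Suc j)) (Y (Suc j))"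
        "t' \<le> Suc ((n - Suc j) * Suc T)" "exec x (WhileNe i a c) (H (Suc j)) (Y (Suc j)) t' (H n) (Y n)"
        using body[OF j] step.IH unfolding execs_def by blast
      show ?thesis
        unfolding execs_def using t(1,3)
        by (intro exI[of _ "Suc (t + t')"] conjI exec_While_ne[OF ne[OF j] t(2,4)]) linarith
    qed
    moreover have "n - j = Suc (n - Suc j)" using step by simp
    then have "(n - j) * Suc T = T + Suc ((n - Suc j) * Suc T)" by (simp only: mult_Suc add_Suc_shift)
    ultimately show ?case by (simp only:)
  qed
  from this[of 0] show ?thesis using assms(4-) by simp
qed

text \<open>The marker occurs in cell 0 only, so testing for symbol 1 is a zero test of the counter,
  on the input tape as well.\<close>

lemma tape_sym_eq_Suc_0_iff: "tape_sym x i p = Suc 0 \<longleftrightarrow> p = 0"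
  by (simp add: tape_sym_def word_cells_def bit_symbol_def)

section \<open>A calculus of text generators\<close>

fun seqs :: "com list \<Rightarrow> com" where
  "seqs [] = Skip"
| "seqs (c # cs) = Seq c (seqs cs)"

lemma wf_seqs: "wf_com m (seqs cs) \<longleftrightarrow> (\<forall>c\<in>set cs. wf_com m c)"
  by (induction cs) auto

definition emits :: "bool list \<Rightarrow> com" where
  "emits bs = seqs (map Emit bs)"

lemma wf_emits: "wf_com m (emits bs)"
  by (auto simp: emits_def wf_seqs)

lemma execs_emits: "execs x (emits bs) h y (Suc (2 * length bs)) h (y @ bs)"
proof (induction bs arbitrary: y)
  case Nil
  then show ?case using execs_Skip by (simp add: emits_def)
next
  case (Cons b bs)
  show ?case
    using execs_Seq[OF execs_Emit Cons, of b y] by (simp add: emits_def)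
qed

text \<open>Registers: tapes 0 and 1 hold loop variables (tape 0, the input tape, also gives access to
  the input), tapes 3 and 4 hold the remaining numbers of iterations, tape 2 holds the bound \<open>B\<close>
  of all loops, tape 5 is scratch space.\<close>

definition ready :: "nat set \<Rightarrow> nat \<Rightarrow> (nat \<Rightarrow> nat) \<Rightarrow> bool" where
  "ready S B h \<longleftrightarrow> (\<forall>v\<in>S. h v = 0 \<and> h (3 + v) = B) \<and> h 2 = B \<and> h 5 = 0 \<and> (\<forall>v<3. h v \<le> B)"

text \<open>\<open>S\<close> contains the loop variables that are at rest and thus available to
  loops in \<open>c\<close>; enclosing loops own the others. Restoring all heads makes generators
  composable, and a time bound in terms of \<open>B\<close> alone can be multiplied through nested
  loops.\<close>

definition generates ::
  "com \<Rightarrow> nat set \<Rightarrow> (bool list \<Rightarrow> nat \<Rightarrow> (nat \<Rightarrow> nat) \<Rightarrow> bool list) \<Rightarrow> bool" where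
  "generates c S d \<longleftrightarrow> wf_com 6 c \<and> (\<exists>T. poly_bounded T \<and>
     (\<forall>x B h y. ready S B h \<longrightarrow> execs x c h y (T B) h (y @ d x B h)))"

lemma generatesI:
  assumes "wf_com 6 c" "poly_bounded T"
    "\<And>x B h y. ready S B h \<Longrightarrow> execs x c h y (T B) h (y @ d x B h)"
  shows "generates c S d"
  using assms unfolding generates_def by blast

lemma generatesE:
  assumes "generates c S d"
  obtains T where "wf_com 6 c" "poly_bounded T"
    "\<forall>x B h y. ready S B h \<longrightarrow> execs x c h y (T B) h (y @ d x B h)"
  using assms unfolding generates_def by blast

lemma ready_mono: "ready S B h \<Longrightarrow> S' \<subseteq> S \<Longrightarrow> ready S' B h"
  by (auto simp: ready_def)

lemma generates_mono: "generates c S' d \<Longrightarrow> S' \<subseteq> S \<Longrightarrow> generates c S d"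
  unfolding generates_def using ready_mono by blast

lemma generates_cong:
  assumes "generates c S d" "\<And>x B h. ready S B h \<Longrightarrow> d x B h = d' x B h"
  shows "generates c S d'"
proof -
  from assms(1) obtain T where T: "wf_com 6 c" "poly_bounded T"
    "\<forall>x B h y. ready S B h \<longrightarrow> execs x c h y (T B) h (y @ d x B h)" by (rule generatesE)
  show ?thesis using assms(2) T(3) by (intro generatesI[OF T(1,2)]) simp
qed

lemma generates_Skip: "generates Skip S (\<lambda>x B h. [])"
  by (rule generatesI[where T = "\<lambda>_. 1"])
    (use execs_Skip in \<open>auto intro: poly_bounded_intros\<close>)

lemma generates_emits: "generates (emits bs) S (\<lambda>x B h. bs)"
  by (rule generatesI[where T = "\<lambda>_. Suc (2 * length bs)"])
    (auto intro: poly_bounded_intros execs_emits wf_emits)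

lemma generates_Seq:
  assumes "generates c S d" "generates c' S d'"
  shows "generates (Seq c c') S (\<lambda>x B h. d x B h @ d' x B h)"
proof -
  from assms(1) obtain T where T: "wf_com 6 c" "poly_bounded T"
    "\<forall>x B h y. ready S B h \<longrightarrow> execs x c h y (T B) h (y @ d x B h)" by (rule generatesE)
  from assms(2) obtain T' where T': "wf_com 6 c'" "poly_bounded T'"
    "\<forall>x B h y. ready S B h \<longrightarrow> execs x c' h y (T' B) h (y @ d' x B h)" by (rule generatesE)
  show ?thesis
  proof (rule generatesI[where T = "\<lambda>B. Suc (T B + T' B)"])
    fix x B h y assume r: "ready S B h"
    show "execs x (Seq c c') h y (Suc (T B + T' B)) h (y @ d x B h @ d' x B h)"
      using execs_Seq[OF T(3)[rule_format, OF r] T'(3)[rule_format, OF r]] by simp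
  qed (use T T' in \<open>auto intro: poly_bounded_intros\<close>)
qed

lemma generates_seqs:
  assumes "\<And>a. a \<in> set as \<Longrightarrow> generates (f a) S (d a)"
  shows "generates (seqs (map f as)) S (\<lambda>x B h. concat (map (\<lambda>a. d a x B h) as))"
  using assms
proof (induction as)
  case Nil
  then show ?case using generates_Skip by simp
next
  case (Cons a as)
  then have "generates (f a) S (d a)"
    "generates (seqs (map f as)) S (\<lambda>x B h. concat (map (\<lambda>a. d a x B h) as))" by simp_all
  from generates_Seq[OF this] show ?case by simp
qed

text \<open>The second loop restores the registers, so that the loop can itself be used in a loop body.\<close>

definition for_each :: "nat \<Rightarrow> com \<Rightarrow> com" where
  "for_each v c =
     Seq (WhileNe (3 + v) 1 (Seq c (Seq (Dec (3 + v)) (Inc v))))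
       (WhileNe v 1 (Seq (Dec v) (Inc (3 + v))))"

lemma generates_for_each:
  assumes c: "generates c (S - {v}) d" and v: "v \<in> S" and S: "S \<subseteq> {0, 1}"
  shows "generates (for_each v c) S
    (\<lambda>x B h. concat (map (\<lambda>j. d x B (h(v := j, 3 + v := B - j))) [0..<B]))"
proof -
  from c obtain T where T: "wf_com 6 c" "poly_bounded T"
    "\<forall>x B h y. ready (S - {v}) B h \<longrightarrow> execs x c h y (T B) h (y @ d x B h)" by (rule generatesE)
  have v2: "v < 2" using v S by auto
  show ?thesis
  proof (rule generatesI[where T = "\<lambda>B. Suc (Suc (B * Suc (Suc (T B + 3))) + Suc (B * Suc 3))"])
    fix x B h y assume r: "ready S B h"
    \<comment> \<open>Zero is the only value that can be tested for on every counter, so the end of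
      the loop is detected on \<open>3 + v\<close>, which counts down while \<open>v\<close> counts
      up; their sum remains \<open>B\<close>.\<close>
    let ?H = "\<lambda>j. h(v := j, 3 + v := B - j)"
    let ?Y = "\<lambda>j. y @ concat (map (\<lambda>j. d x B (?H j)) [0..<j])"
    have h0: "h = ?H 0" using r v by (auto simp: ready_def fun_eq_iff)
    have hB: "h = ?H (B - B)" using h0 by simp
    have hv: "h v = 0" using r v by (simp add: ready_def)
    have body: "execs x (Seq c (Seq (Dec (3 + v)) (Inc v))) (?H j) (?Y j) (Suc (T B + 3))
       (?H (Suc j)) (?Y (Suc j))" if j: "j < B" for j
    proof -
      have "ready (S - {v}) B (?H j)"
        using r v2 j S by (auto simp: ready_def)
      from T(3)[rule_format, OF this, of x "?Y j"]
      have 1: "execs x c (?H j) (?Y j) (T B) (?H j) (?Y (Suc j))" by simp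
      have 2: "execs x (Seq (Dec (3 + v)) (Inc v)) (?H j) (?Y (Suc j)) (Suc (1 + 1))
        ((?H j)(3 + v := ?H j (3 + v) - 1, v := Suc (((?H j)(3 + v := ?H j (3 + v) - 1)) v))) (?Y (Suc j))"
        by (rule execs_Seq[OF execs_Dec execs_Inc])
      have eq: "(?H j)(3 + v := ?H j (3 + v) - 1, v := Suc (((?H j)(3 + v := ?H j (3 + v) - 1)) v))
         = ?H (Suc j)" using v2 j by (auto simp: fun_eq_iff)
      from execs_Seq[OF 1 2[unfolded eq]] show ?thesis by (simp add: numeral_3_eq_3)
    qed
    have fwd: "execs x (WhileNe (3 + v) 1 (Seq c (Seq (Dec (3 + v)) (Inc v)))) h y
       (Suc (B * Suc (Suc (T B + 3)))) (?H B) (?Y B)"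
      by (rule execs_While[where H = "?H" and Y = "?Y", OF _ _ body])
        (use h0 in \<open>auto simp: tape_sym_eq_Suc_0_iff\<close>)
    have rewind: "execs x (Seq (Dec v) (Inc (3 + v))) (?H (B - j)) z 3 (?H (B - Suc j)) z"
      if j: "j < B" for j z
    proof -
      have 2: "execs x (Seq (Dec v) (Inc (3 + v))) (?H (B - j)) z (Suc (1 + 1))
        ((?H (B - j))(v := ?H (B - j) v - 1, 3 + v := Suc (((?H (B - j))(v := ?H (B - j) v - 1)) (3 + v)))) z"
        by (rule execs_Seq[OF execs_Dec execs_Inc])
      have eq: "(?H (B - j))(v := ?H (B - j) v - 1, 3 + v := Suc (((?H (B - j))(v := ?H (B - j) v - 1)) (3 + v)))
         = ?H (B - Suc j)" using v2 j by (auto simp: fun_eq_iff)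
      from 2[unfolded eq] show ?thesis by (simp add: numeral_3_eq_3)
    qed
    have bwd: "execs x (WhileNe v 1 (Seq (Dec v) (Inc (3 + v)))) (?H B) (?Y B) (Suc (B * Suc 3)) h (?Y B)"
      by (rule execs_While[where H = "\<lambda>j. ?H (B - j)" and Y = "\<lambda>_. ?Y B", OF _ _ rewind])
        (use hB hv v2 in \<open>auto simp: tape_sym_eq_Suc_0_iff\<close>)
    show "execs x (for_each v c) h y (Suc (Suc (B * Suc (Suc (T B + 3))) + Suc (B * Suc 3))) h
       (y @ concat (map (\<lambda>j. d x B (h(v := j, 3 + v := B - j))) [0..<B]))"
      unfolding for_each_def by (rule execs_Seq[OF fwd bwd])
  qed (use T v2 in \<open>auto simp: for_each_def intro!: poly_bounded_intros\<close>)
qed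

text \<open>A triple \<open>(a, k, v)\<close> stands for \<open>a\<close> plus \<open>k\<close> times the content of register \<open>v\<close>.\<close>

type_synonym lin = "nat \<times> nat \<times> nat"

definition lin_val :: "(nat \<Rightarrow> nat) \<Rightarrow> lin \<Rightarrow> nat" where
  "lin_val h e = fst e + fst (snd e) * h (snd (snd e))"

text \<open>Reading a counter destroys it. Register 5 collects the value, from which the second loop
  restores register \<open>v\<close>.\<close>

definition emit_lin :: "lin \<Rightarrow> com" where
  "emit_lin e = (case e of (a, k, v) \<Rightarrow>
     seqs [emits (replicate a True),
       WhileNe v 1 (seqs [Dec v, Inc 5, emits (replicate k True)]),
       WhileNe 5 1 (seqs [Dec 5, Inc v]), Emit False])"

lemma generates_emit_lin:
  assumes v: "snd (snd e) < 3"
  shows "generates (emit_lin e) S (\<lambda>x B h. enc_nat (lin_val h e))"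
proof -
  obtain a k v where e: "e = (a, k, v)" by (cases e)
  have v3: "v < 3" using v e by simp
  let ?T = "\<lambda>B. 20 + 2 * a + B * (2 * k + 20)"
  show ?thesis
  proof (rule generatesI[where T = ?T])
    fix x B h y assume r: "ready S B h"
    define n where "n = h v"
    have n: "n \<le> B" "h 5 = 0" using r v3 by (auto simp: ready_def n_def)
    let ?H = "\<lambda>j. h(v := n - j, 5 := j)"
    let ?y = "y @ replicate a True"
    let ?Y = "\<lambda>j. ?y @ replicate (k * j) True"
    have h0: "h = ?H 0" using n by (auto simp: n_def fun_eq_iff)
    have body: "execs x (seqs [Dec v, Inc 5, emits (replicate k True)]) (?H j) (?Y j) (2 * k + 8)
       (?H (Suc j)) (?Y (Suc j))" if j: "j < n" for j
    proof -
      have eq: "(?H j)(v := ?H j v - 1, 5 := Suc (((?H j)(v := ?H j v - 1)) 5)) = ?H (Suc j)"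
        using v3 j by (auto simp: fun_eq_iff)
      have run: "execs x (seqs [Dec v, Inc 5, emits (replicate k True)]) (?H j) (?Y j)
        (Suc (1 + Suc (1 + Suc (Suc (2 * length (replicate k True)) + 1))))
        ((?H j)(v := ?H j v - 1, 5 := Suc (((?H j)(v := ?H j v - 1)) 5))) (?Y j @ replicate k True)"
        unfolding seqs.simps
        by (rule execs_Seq[OF execs_Dec execs_Seq[OF execs_Inc execs_Seq[OF execs_emits execs_Skip]]])
      have "replicate (k * j) True @ replicate k True = replicate (k * Suc j) True"
        by (simp add: replicate_add[symmetric])
      then have eqY: "?Y j @ replicate k True = ?Y (Suc j)" by simp
      show ?thesis
        using run[unfolded eq eqY] by (rule execs_mono) simp
    qed
    have fwd: "execs x (WhileNe v 1 (seqs [Dec v, Inc 5, emits (replicate k True)])) h ?y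
       (Suc (n * Suc (2 * k + 8))) (?H n) (?Y n)"
      by (rule execs_While[where H = "?H" and Y = "?Y", OF _ _ body])
        (use h0 v3 in \<open>auto simp: tape_sym_eq_Suc_0_iff\<close>)
    have rewind: "execs x (seqs [Dec 5, Inc v]) (?H (n - j)) z 6 (?H (n - Suc j)) z"
      if j: "j < n" for j z
    proof -
      have run: "execs x (seqs [Dec 5, Inc v]) (?H (n - j)) z (Suc (1 + Suc (1 + 1)))
        ((?H (n - j))(5 := ?H (n - j) 5 - 1, v := Suc (((?H (n - j))(5 := ?H (n - j) 5 - 1)) v))) z"
        unfolding seqs.simps by (rule execs_Seq[OF execs_Dec execs_Seq[OF execs_Inc execs_Skip]])
      have eq: "(?H (n - j))(5 := ?H (n - j) 5 - 1, v := Suc (((?H (n - j))(5 := ?H (n - j) 5 - 1)) v))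
        = ?H (n - Suc j)"
        using v3 j by (auto simp: fun_eq_iff)
      show ?thesis
        using run[unfolded eq] by (rule execs_mono) simp
    qed
    have hn: "h = ?H (n - n)" using h0 by simp
    have bwd: "execs x (WhileNe 5 1 (seqs [Dec 5, Inc v])) (?H n) (?Y n) (Suc (n * Suc 6)) h (?Y n)"
      by (rule execs_While[where H = "\<lambda>j. ?H (n - j)" and Y = "\<lambda>_. ?Y n", OF _ _ rewind])
        (use hn n v3 in \<open>auto simp: tape_sym_eq_Suc_0_iff\<close>)
    have all: "execs x (emit_lin e) h y
      (Suc (Suc (2 * length (replicate a True)) + Suc (Suc (n * Suc (2 * k + 8)) + Suc (Suc (n * Suc 6) + Suc (1 + 1)))))
      h (?Y n @ [False])"
      unfolding emit_lin_def e prod.case seqs.simps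
      by (rule execs_Seq[OF execs_emits execs_Seq[OF fwd[unfolded seqs.simps]
            execs_Seq[OF bwd[unfolded seqs.simps] execs_Seq[OF execs_Emit execs_Skip]]]])
    have "n * (2 * k + 20) \<le> B * (2 * k + 20)" using n by (intro mult_le_mono1)
    then have "Suc (Suc (2 * length (replicate a True)) + Suc (Suc (n * Suc (2 * k + 8)) + Suc (Suc (n * Suc 6) + Suc (1 + 1)))) \<le> ?T B"
      by (simp add: algebra_simps)
    moreover have "?Y n @ [False] = y @ enc_nat (lin_val h e)"
      by (simp add: enc_nat_def lin_val_def e n_def replicate_add)
    ultimately show "execs x (emit_lin e) h y (?T B) h (y @ enc_nat (lin_val h e))"
      using execs_mono[OF all] by simp
  qed (use v3 e in \<open>auto simp: emit_lin_def wf_emits intro!: poly_bounded_intros\<close>)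
qed

text \<open>Tape 0 is both a loop variable and the input tape: when the variable is
  \<open>j\<close>, its head scans cell \<open>j\<close> of the input. Apart from \<open>B\<close>,
  this is the only way in which generated text depends on the input word.\<close>

definition unless_sym :: "nat list \<Rightarrow> com \<Rightarrow> com" where
  "unless_sym as c = foldr (\<lambda>a c. IfEq 0 a Skip c) as c"

lemma generates_If_Skip:
  assumes c: "generates c S d"
  shows "generates (IfEq 0 a Skip c) S (\<lambda>x B h. if word_cells x (h 0) = a then [] else d x B h)"
proof -
  from c obtain T where T: "wf_com 6 c" "poly_bounded T"
    "\<forall>x B h y. ready S B h \<longrightarrow> execs x c h y (T B) h (y @ d x B h)" by (rule generatesE)
  show ?thesis
  proof (rule generatesI[where T = "\<lambda>B. Suc (T B + 1)"])
    fix x B h y assume r: "ready S B h"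
    show "execs x (IfEq 0 a Skip c) h y (Suc (T B + 1)) h
      (y @ (if word_cells x (h 0) = a then [] else d x B h))"
      using execs_mono[OF T(3)[rule_format, OF r], of "T B + 1" x y] execs_mono[OF execs_Skip, of "T B + 1" x h y]
      by (intro execs_If) (auto simp: tape_sym_def tape_word_def)
  qed (use T in \<open>auto intro!: poly_bounded_intros\<close>)
qed

lemma generates_unless_sym:
  assumes c: "generates c S d"
  shows "generates (unless_sym as c) S
    (\<lambda>x B h. if word_cells x (h 0) \<in> set as then [] else d x B h)"
proof (induction as)
  case Nil
  then show ?case using c by (simp add: unless_sym_def)
next
  case (Cons a as)
  show ?case
    by (rule generates_cong, unfold unless_sym_def foldr_Cons o_def,
        rule generates_If_Skip[OF Cons[unfolded unless_sym_def]]) auto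
qed


section \<open>LCL problems from locally checkable words\<close>

text \<open>Two letters suffice to leave the secret undetermined; hence the lower bound assumes
  \<open>K \<ge> 2\<close>.\<close>

definition secret :: "nat \<Rightarrow> nat" where
  "secret a = (if a = 0 then 0 else 1)"

text \<open>Output 0 or 1 asserts that this is the secret of the first node, output 2 asserts that an
  error has already been exhibited, and \<open>countdown K e d\<close> asserts that the node \<open>d\<close> steps further
  on has input \<open>e\<close>, which is an error.\<close>

definition countdown :: "nat \<Rightarrow> nat \<Rightarrow> nat \<Rightarrow> nat" where
  "countdown K e d = 3 + e + K * d"

text \<open>Length 0 is listed separately so that the lengths 1 to \<open>B\<close> match a loop
  with \<open>B\<close> rounds; the order is the one in which the program emits the labels.\<close>

definition outputs :: "nat \<Rightarrow> nat \<Rightarrow> nat list" where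
  "outputs K B = [0, 1, 2] @ map (\<lambda>e. countdown K e 0) [0..<K] @
     concat (map (\<lambda>j. map (\<lambda>e. countdown K e (Suc j)) [0..<K]) [0..<B])"

section \<open>Radius-1 neighbourhoods of oriented paths\<close>

definition path1 :: "nat \<times> nat \<Rightarrow> graph_desc" where
  "path1 p = \<lparr>node_labels = [p], arc_list = [], centre_node = 0\<rparr>"

definition path2 :: "nat \<Rightarrow> nat \<times> nat \<Rightarrow> nat \<times> nat \<Rightarrow> graph_desc" where
  "path2 v p q = \<lparr>node_labels = [p, q], arc_list = [(0, 1)], centre_node = v\<rparr>"

definition path3 :: "nat \<times> nat \<Rightarrow> nat \<times> nat \<Rightarrow> nat \<times> nat \<Rightarrow> graph_desc" where
  "path3 p q r = \<lparr>node_labels = [p, q, r], arc_list = [(0, 1), (1, 2)], centre_node = 1\<rparr>"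

definition ball1 :: "nat \<Rightarrow> nat \<Rightarrow> nat set" where
  "ball1 n v = {u. u < n \<and> u \<le> v + 1 \<and> v \<le> u + 1}"

lemma ball1_eq:
  assumes "v < n"
  shows "ball1 n v = (if v = 0 then {} else {v - 1}) \<union> (if Suc v < n then {Suc v} else {}) \<union> {v}"
  using assms by (auto simp: ball1_def)

lemma card_ball1:
  assumes "v < n"
  shows "card (ball1 n v) = (if v = 0 then 0 else 1) + (if Suc v < n then 1 else 0) + (1::nat)"
  unfolding ball1_eq[OF assms] by auto

lemma cgraph_iso_ball1:
  "cgraph_iso (path_nbhd n inp out 1 v) (graph_of g) \<longleftrightarrow>
    (\<exists>h. bij_betw h (ball1 n v) {..<length (node_labels g)} \<and>
       (\<forall>u\<in>ball1 n v. \<forall>w\<in>ball1 n v. w = Suc u \<longleftrightarrow> (h u, h w) \<in> set (arc_list g)) \<and>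
       (\<forall>u\<in>ball1 n v. node_labels g ! h u = (inp u, out u)) \<and> h v = centre_node g)"
  unfolding cgraph_iso_def path_nbhd_def ball1_def[symmetric] graph_of_def Let_def
  by (rule arg_cong[of _ _ Ex]) (auto simp: fun_eq_iff)

text \<open>The size of the ball already separates the one-node path, the end nodes and the interior
  nodes.\<close>

lemma iso_card:
  assumes "cgraph_iso (path_nbhd n inp out 1 v) (graph_of g)"
  shows "card (ball1 n v) = length (node_labels g)"
  using assms unfolding cgraph_iso_ball1 by (auto dest: bij_betw_same_card)

lemma path1_iso_iff:
  assumes "v < n"
  shows "cgraph_iso (path_nbhd n inp out 1 v) (graph_of (path1 p)) \<longleftrightarrow>
    v = 0 \<and> n = 1 \<and> p = (inp 0, out 0)"
proof
  assume iso: "cgraph_iso (path_nbhd n inp out 1 v) (graph_of (path1 p))"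
  then have vn: "v = 0" "n = 1"
    using iso_card[OF iso] card_ball1[OF assms] assms
    by (cases "v = 0"; cases "Suc v < n"; simp add: path1_def)+
  with iso show "v = 0 \<and> n = 1 \<and> p = (inp 0, out 0)"
    unfolding cgraph_iso_ball1 by (auto simp: path1_def ball1_eq)
next
  assume vn: "v = 0 \<and> n = 1 \<and> p = (inp 0, out 0)"
  then show "cgraph_iso (path_nbhd n inp out 1 v) (graph_of (path1 p))"
    unfolding cgraph_iso_ball1
    by (intro exI[of _ id]) (auto simp: path1_def ball1_eq bij_betw_def)
qed

text \<open>Two-node balls occur at both ends of a path; the orientation decides between them, since
  a centre without an incoming arc must be the first node.\<close>

lemma path2_first_iso_iff:
  assumes "v < n"
  shows "cgraph_iso (path_nbhd n inp out 1 v) (graph_of (path2 0 p q)) \<longleftrightarrow>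
    v = 0 \<and> n \<ge> 2 \<and> p = (inp 0, out 0) \<and> q = (inp 1, out 1)"
proof
  assume iso: "cgraph_iso (path_nbhd n inp out 1 v) (graph_of (path2 0 p q))"
  obtain h where h:
    "\<And>u w. u \<in> ball1 n v \<Longrightarrow> w \<in> ball1 n v \<Longrightarrow> w = Suc u \<longleftrightarrow> (h u, h w) \<in> {(0, 1)}"
    "\<And>u. u \<in> ball1 n v \<Longrightarrow> [p, q] ! h u = (inp u, out u)" "h v = 0"
    using iso unfolding cgraph_iso_ball1 path2_def by auto
  have c: "card (ball1 n v) = 2" using iso_card[OF iso] by (simp add: path2_def)
  have v: "v = 0"
  proof (rule ccontr)
    assume "v \<noteq> 0"
    then show False using h(1)[of "v - 1" v] h(3) assms by (auto simp: ball1_eq)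
  qed
  with c have n: "n \<ge> 2" using card_ball1[OF assms] by (cases "Suc v < n") simp_all
  from v n have "h 1 = 1" using h(1)[of 0 1] by (auto simp: ball1_eq)
  with v n h(3) show "v = 0 \<and> n \<ge> 2 \<and> p = (inp 0, out 0) \<and> q = (inp 1, out 1)"
    using h(2)[of 0] h(2)[of 1] by (auto simp: ball1_eq)
next
  assume v: "v = 0 \<and> n \<ge> 2 \<and> p = (inp 0, out 0) \<and> q = (inp 1, out 1)"
  then have B: "ball1 n v = {0, 1}" using assms by (auto simp: ball1_eq)
  have bij: "bij_betw id {0, 1} {..<2::nat}" by (auto simp: bij_betw_def)
  from v show "cgraph_iso (path_nbhd n inp out 1 v) (graph_of (path2 0 p q))"
    unfolding cgraph_iso_ball1 B by (intro exI[of _ id]) (use bij in \<open>auto simp: path2_def numeral_2_eq_2\<close>)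
qed

lemma path2_last_iso_iff:
  assumes "v < n"
  shows "cgraph_iso (path_nbhd n inp out 1 v) (graph_of (path2 1 p q)) \<longleftrightarrow>
    v \<ge> 1 \<and> Suc v = n \<and> p = (inp (v - 1), out (v - 1)) \<and> q = (inp v, out v)"
proof
  assume iso: "cgraph_iso (path_nbhd n inp out 1 v) (graph_of (path2 1 p q))"
  obtain h where h:
    "\<And>u w. u \<in> ball1 n v \<Longrightarrow> w \<in> ball1 n v \<Longrightarrow> w = Suc u \<longleftrightarrow> (h u, h w) \<in> {(0, 1)}"
    "\<And>u. u \<in> ball1 n v \<Longrightarrow> [p, q] ! h u = (inp u, out u)" "h v = 1"
    using iso unfolding cgraph_iso_ball1 path2_def by auto
  have c: "card (ball1 n v) = 2" using iso_card[OF iso] by (simp add: path2_def)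
  have n: "Suc v = n"
  proof (rule ccontr)
    assume "Suc v \<noteq> n"
    then show False using h(1)[of v "Suc v"] h(3) assms by (auto simp: ball1_eq)
  qed
  with c have v: "v \<ge> 1" using card_ball1[OF assms] by (cases "v = 0") simp_all
  from v n have "h (v - 1) = 0" using h(1)[of "v - 1" v] by (auto simp: ball1_eq)
  with v n h(3) show "v \<ge> 1 \<and> Suc v = n \<and> p = (inp (v - 1), out (v - 1)) \<and> q = (inp v, out v)"
    using h(2)[of "v - 1"] h(2)[of v] by (auto simp: ball1_eq)
next
  assume v: "v \<ge> 1 \<and> Suc v = n \<and> p = (inp (v - 1), out (v - 1)) \<and> q = (inp v, out v)"
  then have B: "ball1 n v = {v - 1, v}" using assms by (auto simp: ball1_eq)
  let ?h = "\<lambda>u. if u = v then 1 else 0 :: nat"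
  have bij: "bij_betw ?h {v - 1, v} {..<2::nat}"
    using v by (auto simp: bij_betw_def inj_on_def)
  from v show "cgraph_iso (path_nbhd n inp out 1 v) (graph_of (path2 1 p q))"
    unfolding cgraph_iso_ball1 B by (intro exI[of _ ?h]) (use bij in \<open>auto simp: path2_def numeral_2_eq_2\<close>)
qed

lemma path3_iso_iff:
  assumes "v < n"
  shows "cgraph_iso (path_nbhd n inp out 1 v) (graph_of (path3 p q r)) \<longleftrightarrow>
    v \<ge> 1 \<and> Suc v < n \<and> p = (inp (v - 1), out (v - 1)) \<and> q = (inp v, out v) \<and>
    r = (inp (Suc v), out (Suc v))"
proof
  assume iso: "cgraph_iso (path_nbhd n inp out 1 v) (graph_of (path3 p q r))"
  obtain h where h:
    "\<And>u w. u \<in> ball1 n v \<Longrightarrow> w \<in> ball1 n v \<Longrightarrow> w = Suc u \<longleftrightarrow> (h u, h w) \<in> {(0, 1), (1, 2)}"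
    "\<And>u. u \<in> ball1 n v \<Longrightarrow> [p, q, r] ! h u = (inp u, out u)" "h v = 1"
    using iso unfolding cgraph_iso_ball1 path3_def by auto
  have "card (ball1 n v) = 3" using iso_card[OF iso] by (simp add: path3_def)
  then have v: "v \<ge> 1" "Suc v < n"
    using card_ball1[OF assms] by (cases "v = 0"; cases "Suc v < n"; simp)+
  then have "h (v - 1) = 0" using h(1)[of "v - 1" v] h(3) by (auto simp: ball1_eq)
  moreover from v have "h (Suc v) = 2" using h(1)[of v "Suc v"] h(3) by (auto simp: ball1_eq)
  ultimately show "v \<ge> 1 \<and> Suc v < n \<and> p = (inp (v - 1), out (v - 1)) \<and> q = (inp v, out v) \<and>
    r = (inp (Suc v), out (Suc v))"
    using v h(2)[of "v - 1"] h(2)[of v] h(2)[of "Suc v"] h(3) by (auto simp: ball1_eq)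
next
  assume v: "v \<ge> 1 \<and> Suc v < n \<and> p = (inp (v - 1), out (v - 1)) \<and> q = (inp v, out v) \<and>
    r = (inp (Suc v), out (Suc v))"
  then have B: "ball1 n v = {v - 1, v, Suc v}" using assms by (auto simp: ball1_eq)
  let ?h = "\<lambda>u. if u = v then 1 else if u < v then 0 else 2 :: nat"
  have bij: "bij_betw ?h {v - 1, v, Suc v} {..<3::nat}"
    using v by (auto simp: bij_betw_def inj_on_def)
  from v show "cgraph_iso (path_nbhd n inp out 1 v) (graph_of (path3 p q r))"
    unfolding cgraph_iso_ball1 B by (intro exI[of _ ?h]) (use bij in \<open>auto simp: path3_def numeral_3_eq_3\<close>)
qed

lemma correct_output_cong:
  assumes "correct_output P n inp out'" "\<And>v. v < n \<Longrightarrow> out v = out' v"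
  shows "correct_output P n inp out"
proof -
  have "cgraph_iso (path_nbhd n inp out r v) G \<longleftrightarrow> cgraph_iso (path_nbhd n inp out' r v) G"
    for r v and G :: "nat cgraph"
    by (simp add: cgraph_iso_def path_nbhd_def Let_def assms(2))
  then show ?thesis using assms by (simp add: correct_output_def)
qed

text \<open>An infinite word of letters below \<open>K\<close> is valid if its letters at positions \<open>1, \<dots>, B\<close> are
  given by \<open>start\<close> and those at positions \<open>v - 1\<close>, \<open>v\<close>, \<open>v + 1\<close> and \<open>v + B\<close> are related by \<open>R\<close>.
  The letter at position 0 carries the secret; rules that matter ignore it.\<close>

locale tiling =
  fixes K B :: nat
    and start :: "nat \<Rightarrow> nat"
    and R :: "nat \<Rightarrow> nat \<Rightarrow> nat \<Rightarrow> nat \<Rightarrow> bool"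
begin

text \<open>Errors in the first block are reported by the first node, which recognises itself and so
  knows all distances. \<open>start\<close> is evaluated when the problem is written down, so this
  is where the input word is built into it.\<close>

definition first_labels :: "(nat \<times> nat) list" where
  "first_labels = map (\<lambda>a. (a, secret a)) [0..<K] @
     concat (map (\<lambda>j. concat (map (\<lambda>a.
       map (\<lambda>e. (a, countdown K e (Suc j))) (filter (\<lambda>e. e \<noteq> start j) [0..<K])) [0..<K])) [0..<B])"

text \<open>A node with a successor may carry \<open>countdown K a 0\<close> only on the letter
  \<open>a\<close>: here a report is verified. Only afterwards is label 2 available, and a running
  countdown cannot be dropped.\<close>

definition steps :: "((nat \<times> nat) \<times> (nat \<times> nat)) list" where
  "steps =
     concat (map (\<lambda>a. concat (map (\<lambda>b. map (\<lambda>s. ((a, s), (b, s))) [0, 1, 2]) [0..<K])) [0..<K]) @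
     concat (map (\<lambda>a. map (\<lambda>b. ((a, countdown K a 0), (b, 2))) [0..<K]) [0..<K]) @
     concat (map (\<lambda>j. concat (map (\<lambda>a. concat (map (\<lambda>b.
       map (\<lambda>e. ((a, countdown K e (Suc j)), (b, countdown K e j))) [0..<K]) [0..<K])) [0..<K])) [0..<B])"

text \<open>Radius 1 shows three of the letters related by \<open>R\<close>; the fourth is guessed
  as \<open>e\<close>. Since a countdown can start only behind a secret label, a path carries at
  most one report.\<close>

definition guesses :: "((nat \<times> nat) \<times> (nat \<times> nat) \<times> nat) list" where
  "guesses = concat (map (\<lambda>a. concat (map (\<lambda>b. concat (map (\<lambda>b'. concat (map (\<lambda>e.
     map (\<lambda>s. ((a, s), (b, countdown K e B), b')) [0, 1])
     (filter (\<lambda>e. \<not> R a b b' e) [0..<K]))) [0..<K])) [0..<K])) [0..<K])"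

text \<open>A node answers for the pair formed with its predecessor, the first node for itself. A
  successor may show any output label, because it answers for that label itself. A guess refers to
  the successor's letter and is therefore not offered to the last node.\<close>

definition tiling_lcl :: lcl where
  "tiling_lcl = \<lparr>in_labels = [0..<K], out_labels = outputs K B, radius = 1,
     allowed =
       map (\<lambda>a. path1 (a, secret a)) [0..<K] @
       concat (map (\<lambda>p. concat (map (\<lambda>z. map (\<lambda>b. path2 0 p (b, z)) [0..<K]) (outputs K B))) first_labels) @
       map (\<lambda>(p, q). path2 1 p q) steps @
       concat (map (\<lambda>(p, q). concat (map (\<lambda>z. map (\<lambda>b. path3 p q (b, z)) [0..<K]) (outputs K B))) steps) @
       concat (map (\<lambda>(p, q, b). map (\<lambda>z. path3 p q (b, z)) (outputs K B)) guesses)\<rparr>"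

lemma bex_concat: "(\<exists>x\<in>set (concat xss). Q x) \<longleftrightarrow> (\<exists>xs\<in>set xss. \<exists>x\<in>set xs. Q x)"
  by auto

lemma bex_map: "(\<exists>x\<in>set (map f xs). Q x) \<longleftrightarrow> (\<exists>x\<in>set xs. Q (f x))"
  by auto

lemma bex_upt: "(\<exists>x\<in>set [0..<k]. Q x) \<longleftrightarrow> (\<exists>x<k. Q x)"
  by auto

lemma in_outputs_iff:
  "z \<in> set (outputs K B) \<longleftrightarrow> z \<le> 2 \<or> (\<exists>e d. e < K \<and> d \<le> B \<and> z = countdown K e d)"
  (is "?l \<longleftrightarrow> ?r")
proof
  assume ?l
  then show ?r by (auto simp: outputs_def) (metis Suc_leI zero_le)+
next
  assume ?r
  then consider "z \<le> 2" | e d where "e < K" "d \<le> B" "z = countdown K e d" by blast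
  then show ?l
  proof cases
    case 1
    then show ?thesis by (auto simp: outputs_def)
  next
    case 2
    then show ?thesis by (cases d) (fastforce simp: outputs_def)+
  qed
qed

lemma small_output: "z \<le> 2 \<Longrightarrow> z \<in> set (outputs K B)"
  and countdown_output: "e < K \<Longrightarrow> d \<le> B \<Longrightarrow> countdown K e d \<in> set (outputs K B)"
  unfolding in_outputs_iff by blast+

lemma in_first_labels_iff:
  "(a, z) \<in> set first_labels \<longleftrightarrow> a < K \<and> (z = secret a \<or>
     (\<exists>j e. j < B \<and> e < K \<and> e \<noteq> start j \<and> z = countdown K e (Suc j)))"
  by (auto simp: first_labels_def) force

lemma in_steps_iff:
  "((a, y), (b, z)) \<in> set steps \<longleftrightarrow> a < K \<and> b < K \<and>
     (y = z \<and> y \<le> 2 \<or> y = countdown K a 0 \<and> z = 2 \<or>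
      (\<exists>j e. j < B \<and> e < K \<and> y = countdown K e (Suc j) \<and> z = countdown K e j))"
proof -
  have y: "y \<le> 2 \<longleftrightarrow> y = 0 \<or> y = 1 \<or> y = 2" by auto
  have "((a, y), (b, z)) \<in> set steps \<longleftrightarrow> (\<exists>x\<in>set steps. x = ((a, y), (b, z)))" by simp
  also have "\<dots> \<longleftrightarrow> (\<exists>a'<K. \<exists>b'<K. a' = a \<and> b' = b \<and> y = z \<and> (y = 0 \<or> y = 1 \<or> y = 2)) \<or>
     (\<exists>a'<K. \<exists>b'<K. a' = a \<and> countdown K a' 0 = y \<and> b' = b \<and> z = 2) \<or>
     (\<exists>j<B. \<exists>a'<K. \<exists>b'<K. \<exists>e<K.
        a' = a \<and> countdown K e (Suc j) = y \<and> b' = b \<and> countdown K e j = z)"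
    unfolding steps_def set_append bex_Un bex_concat bex_map bex_upt
    by (rule disj_cong disj_cong[OF _ disj_cong])+ auto
  also have "\<dots> \<longleftrightarrow> a < K \<and> b < K \<and>
     (y = z \<and> y \<le> 2 \<or> y = countdown K a 0 \<and> z = 2 \<or>
      (\<exists>j e. j < B \<and> e < K \<and> y = countdown K e (Suc j) \<and> z = countdown K e j))"
    unfolding y by blast
  finally show ?thesis .
qed

lemma in_guesses_iff:
  "((a, y), (b, z), b') \<in> set guesses \<longleftrightarrow> a < K \<and> b < K \<and> b' < K \<and> y \<le> 1 \<and>
     (\<exists>e. e < K \<and> \<not> R a b b' e \<and> z = countdown K e B)"
proof -
  have "y \<le> 1 \<longleftrightarrow> y = 0 \<or> y = 1" by auto
  then show ?thesis by (auto simp: guesses_def) fastforce+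
qed

lemma allowed_iff:
  assumes "v < n"
  shows "(\<exists>g \<in> set (allowed tiling_lcl). cgraph_iso (path_nbhd n inp out 1 v) (graph_of g)) \<longleftrightarrow>
    (if n = 1 then inp 0 < K \<and> out 0 = secret (inp 0)
     else if v = 0 then
       (inp 0, out 0) \<in> set first_labels \<and> inp 1 < K \<and> out 1 \<in> set (outputs K B)
     else if Suc v = n then
       ((inp (v - 1), out (v - 1)), (inp v, out v)) \<in> set steps
     else inp (Suc v) < K \<and> out (Suc v) \<in> set (outputs K B) \<and>
       (((inp (v - 1), out (v - 1)), (inp v, out v)) \<in> set steps \<or>
        ((inp (v - 1), out (v - 1)), (inp v, out v), inp (Suc v)) \<in> set guesses))"
proof -
  have guess: "b < K" if "(p, q, b) \<in> set guesses" for p q b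
    using that by (cases p; cases q) (auto simp: in_guesses_iff)
  let ?iso = "\<lambda>g. cgraph_iso (path_nbhd n inp out 1 v) (graph_of g)"
  have "(\<exists>g \<in> set (allowed tiling_lcl). ?iso g) \<longleftrightarrow>
     (\<exists>a<K. ?iso (path1 (a, secret a))) \<or>
     (\<exists>p\<in>set first_labels. \<exists>z\<in>set (outputs K B). \<exists>b<K. ?iso (path2 0 p (b, z))) \<or>
     (\<exists>(p, q)\<in>set steps. ?iso (path2 1 p q)) \<or>
     (\<exists>(p, q)\<in>set steps. \<exists>z\<in>set (outputs K B). \<exists>b<K. ?iso (path3 p q (b, z))) \<or>
     (\<exists>(p, q, b)\<in>set guesses. \<exists>z\<in>set (outputs K B). ?iso (path3 p q (b, z)))"
    by (simp add: tiling_lcl_def bex_Un bex_concat bex_map bex_upt split_beta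
        del: set_concat set_map set_upt)
  also have "\<dots> \<longleftrightarrow>
    (if n = 1 then inp 0 < K \<and> out 0 = secret (inp 0)
     else if v = 0 then
       (inp 0, out 0) \<in> set first_labels \<and> inp 1 < K \<and> out 1 \<in> set (outputs K B)
     else if Suc v = n then
       ((inp (v - 1), out (v - 1)), (inp v, out v)) \<in> set steps
     else inp (Suc v) < K \<and> out (Suc v) \<in> set (outputs K B) \<and>
       (((inp (v - 1), out (v - 1)), (inp v, out v)) \<in> set steps \<or>
        ((inp (v - 1), out (v - 1)), (inp v, out v), inp (Suc v)) \<in> set guesses))"
    unfolding path1_iso_iff[OF assms] path2_first_iso_iff[OF assms] path2_last_iso_iff[OF assms]
      path3_iso_iff[OF assms]
    using assms by (cases "n = 1"; cases "v = 0"; cases "Suc v = n") (auto simp: Bex_def split_def guess)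
  finally show ?thesis .
qed


lemma correct_output_iff:
  "correct_output tiling_lcl n inp out \<longleftrightarrow> (\<forall>v<n. out v \<in> set (outputs K B) \<and>
    (if n = 1 then inp 0 < K \<and> out 0 = secret (inp 0)
     else if v = 0 then
       (inp 0, out 0) \<in> set first_labels \<and> inp 1 < K \<and> out 1 \<in> set (outputs K B)
     else if Suc v = n then
       ((inp (v - 1), out (v - 1)), (inp v, out v)) \<in> set steps
     else inp (Suc v) < K \<and> out (Suc v) \<in> set (outputs K B) \<and>
       (((inp (v - 1), out (v - 1)), (inp v, out v)) \<in> set steps \<or>
        ((inp (v - 1), out (v - 1)), (inp v, out v), inp (Suc v)) \<in> set guesses)))"
proof -
  have "out_labels tiling_lcl = outputs K B" "radius tiling_lcl = 1"
    by (simp_all add: tiling_lcl_def)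
  then show ?thesis unfolding correct_output_def using allowed_iff[of _ n inp out] by auto
qed

lemma valid_tiling_lcl:
  assumes "K \<ge> 1"
  shows "valid_lcl tiling_lcl"
proof -
  have out: "z \<in> set (outputs K B)" if "((a, y), (b, z)) \<in> set steps \<or> ((a, y), (b, z), b') \<in> set guesses
     \<or> ((b, z), (a, y)) \<in> set steps \<or> ((b, z), (a, y), b') \<in> set guesses" for a y b z b'
  proof -
    show ?thesis
      using that small_output countdown_output unfolding in_steps_iff in_guesses_iff by (elim disjE conjE exE) simp_all
  qed
  have inp: "a < K \<and> b < K" if "((a, y), (b, z)) \<in> set steps \<or> ((a, y), (b, z), b') \<in> set guesses" for a y b z b'
    using that unfolding in_outputs_iff in_steps_iff in_guesses_iff by auto
  have inp3: "b' < K" if "((a, y), (b, z), b') \<in> set guesses" for a y b z b'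
    using that unfolding in_guesses_iff by auto
  have first: "a < K" "z \<in> set (outputs K B)" if "(a, z) \<in> set first_labels" for a z
    using that small_output countdown_output unfolding in_first_labels_iff secret_def
    by (auto simp: Suc_leI split: if_splits)
  have sec: "secret a \<in> set (outputs K B)" for a
    by (auto simp: secret_def in_outputs_iff)
  let ?S = "{..<K} \<times> set (outputs K B)"
  have "set (node_labels g) \<subseteq> ?S \<and> centre_node g < length (node_labels g) \<and>
     set (arc_list g) \<subseteq> {..<length (node_labels g)} \<times> {..<length (node_labels g)}"
    if "g \<in> set (allowed tiling_lcl)" for g
    using that unfolding tiling_lcl_def
    apply (auto simp: path1_def path2_def path3_def sec dest: first)
    apply (use out inp inp3 in blast)+
    done
  moreover have "outputs K B \<noteq> []" by (simp add: outputs_def)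
  moreover have "in_labels tiling_lcl = [0..<K]" "out_labels tiling_lcl = outputs K B"
    by (simp_all add: tiling_lcl_def)
  ultimately show ?thesis using assms unfolding valid_lcl_def
    by (simp add: atLeast0LessThan)
qed

section \<open>Valid words force the secret\<close>

lemma countdown_gt: "countdown K e d > 2"
  by (simp add: countdown_def)

text \<open>\<open>e + K * d\<close> is a number in base \<open>K\<close> with last digit
  \<open>e\<close>.\<close>

lemma countdown_inject:
  assumes "e < K" "e' < K"
  shows "countdown K e d = countdown K e' d' \<longleftrightarrow> e = e' \<and> d = d'"
proof
  assume "countdown K e d = countdown K e' d'"
  then have eq: "e + K * d = e' + K * d'" by (simp add: countdown_def)
  have "e = e'" using arg_cong[OF eq, of "\<lambda>z. z mod K"] assms by simp
  with eq assms show "e = e' \<and> d = d'" by auto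
qed simp

definition valid_word :: "(nat \<Rightarrow> nat) \<Rightarrow> nat \<Rightarrow> bool" where
  "valid_word w n \<longleftrightarrow> (\<forall>j<B. Suc j < n \<longrightarrow> w (Suc j) = start j) \<and>
     (\<forall>v\<ge>1. v + B < n \<longrightarrow> R (w (v - 1)) (w v) (w (v + 1)) (w (v + B)))"

lemma steps_or_guesses:
  assumes "correct_output tiling_lcl n inp out" "Suc v < n"
  shows "((inp v, out v), (inp (Suc v), out (Suc v))) \<in> set steps \<or>
    ((inp v, out v), (inp (Suc v), out (Suc v)), inp (Suc (Suc v))) \<in> set guesses"
  using assms(1)[unfolded correct_output_iff, rule_format, of "Suc v"] assms(2)
  by (auto split: if_splits)

text \<open>On a valid word every countdown is bound to fail, unless the path ends before.\<close>

definition false_report :: "nat \<Rightarrow> (nat \<Rightarrow> nat) \<Rightarrow> (nat \<Rightarrow> nat) \<Rightarrow> nat \<Rightarrow> bool" where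
  "false_report n inp out v \<longleftrightarrow>
     (\<exists>e d. e < K \<and> d \<le> B \<and> out v = countdown K e d \<and> (v + d < n \<longrightarrow> inp (v + d) \<noteq> e))"

lemma false_reportI:
  assumes "e < K" "d \<le> B" "out v = countdown K e d" "v + d < n \<Longrightarrow> inp (v + d) \<noteq> e"
  shows "false_report n inp out v"
  unfolding false_report_def
  by (rule exI[of _ e], rule exI[of _ d]) (use assms in simp)

text \<open>Every way of starting a countdown names a letter that a valid word does not have at the
  target, and counting down keeps the target. Label 2 cannot appear, since it would have to follow a
  countdown that ended on the right letter.\<close>

lemma outputs_on_valid_word:
  assumes cor: "correct_output tiling_lcl n inp out" and n: "n \<ge> 2" and val: "valid_word inp n"
    and v: "v < n"
  shows "out v = secret (inp 0) \<or> false_report n inp out v"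
  using v
proof (induction v)
  case 0
  have "(inp 0, out 0) \<in> set first_labels"
    using cor[unfolded correct_output_iff, rule_format, of 0] n by (auto split: if_splits)
  then consider "out 0 = secret (inp 0)"
    | j e where "j < B" "e < K" "e \<noteq> start j" "out 0 = countdown K e (Suc j)"
    unfolding in_first_labels_iff by blast
  then show ?case
  proof cases
    case (2 j e)
    then have "inp (0 + Suc j) \<noteq> e" if "0 + Suc j < n" using val that by (auto simp: valid_word_def)
    moreover have "Suc j \<le> B" using 2(1) by simp
    ultimately show ?thesis using false_reportI[of e "Suc j" out 0 n inp] 2(2,4) by simp
  qed simp
next
  case (Suc v)
  then have IH: "out v = secret (inp 0) \<or> false_report n inp out v"
    by simp
  have small: "countdown K e d \<noteq> secret (inp 0)" for e d
    using countdown_gt[of e d] by (simp add: secret_def)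
  \<comment> \<open>The label determines both \<open>e\<close> and \<open>d\<close>, so the
    existential statement of the induction hypothesis applies to any decomposition of
    \<open>out v\<close>.\<close>
  have IHc: "inp (v + d) \<noteq> e" if ed: "out v = countdown K e d" "e < K" "v + d < n" for e d
  proof -
    obtain e' d' where "e' < K" "out v = countdown K e' d'" "v + d' < n \<longrightarrow> inp (v + d') \<noteq> e'"
      using IH ed(1) small by (auto simp: false_report_def)
    then show ?thesis using ed countdown_inject[of e e' d d'] by auto
  qed
  let ?concl = "out (Suc v) = secret (inp 0) \<or> false_report n inp out (Suc v)"
  have copy: ?concl if "out v = out (Suc v)" "out v \<le> 2"
  proof -
    have "out v \<noteq> countdown K e d" for e d
      using countdown_gt[of e d] that by linarith
    then show ?thesis using IH that by (auto simp: false_report_def)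
  qed
  have last: ?concl if "out v = countdown K (inp v) 0" "inp v < K"
    using IHc[of "inp v" 0] Suc.prems that by simp
  have count: ?concl
    if "j < B" "e < K" "out v = countdown K e (Suc j)" "out (Suc v) = countdown K e j" for j e
  proof -
    have "inp (Suc v + j) \<noteq> e" if "Suc v + j < n"
      using IHc[of e "Suc j"] that \<open>e < K\<close> \<open>out v = countdown K e (Suc j)\<close> by simp
    then have "false_report n inp out (Suc v)"
      using that false_reportI[of e j out "Suc v" n inp] by simp
    then show ?thesis ..
  qed
  have guess: ?concl
    if "e < K" "\<not> R (inp v) (inp (Suc v)) (inp (Suc (Suc v))) e" "out (Suc v) = countdown K e B" for e
  proof -
    have "inp (Suc v + B) \<noteq> e" if "Suc v + B < n"
    proof -
      have "R (inp (Suc v - 1)) (inp (Suc v)) (inp (Suc v + 1)) (inp (Suc v + B))"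
        using val that unfolding valid_word_def by (metis le_add1 plus_1_eq_Suc)
      then show ?thesis using \<open>\<not> R _ _ _ _\<close> by auto
    qed
    then have "false_report n inp out (Suc v)"
      using that false_reportI[of e B out "Suc v" n inp] by simp
    then show ?thesis ..
  qed
  from steps_or_guesses[OF cor Suc.prems] show ?case
    unfolding in_steps_iff in_guesses_iff
    by (elim disjE conjE exE) (erule copy last count guess; assumption)+
qed

text \<open>A false report at \<open>v\<close> cannot be abandoned and ends at \<open>v + d\<close>,
  where \<open>d \<le> B\<close>. The margin \<open>B + 1\<close> guarantees that node
  \<open>v + d\<close> still has a successor, so that its label is verified against its
  letter.\<close>

lemma secret_forced:
  assumes cor: "correct_output tiling_lcl n inp out" and val: "valid_word inp n"
    and v: "v + B + 1 < n"
  shows "out v = secret (inp 0)"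
proof (rule ccontr)
  assume ne: "out v \<noteq> secret (inp 0)"
  have n: "n \<ge> 2" using v by simp
  note inv = outputs_on_valid_word[OF cor n val]
  obtain e d where e: "e < K" "d \<le> B" "out v = countdown K e d"
    using inv[of v] v ne by (auto simp: false_report_def)
  have run: "out (v + i) = countdown K e (d - i)" if "i \<le> d" for i
    using that
  proof (induction i)
    case (Suc i)
    then have out: "out (v + i) = countdown K e (d - i)" by simp
    have di: "d - i \<noteq> 0" using Suc by simp
    have "Suc (v + i) < n" using Suc e v by simp
    from steps_or_guesses[OF cor this] obtain j e' where j: "e' < K" "out (v + i) = countdown K e' (Suc j)"
       "out (Suc (v + i)) = countdown K e' j"
      unfolding in_steps_iff in_guesses_iff out
      using countdown_gt[of e "d - i"] countdown_inject[OF e(1), of "inp (v + i)" "d - i" 0] di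
      by auto
    then have "e = e' \<and> d - i = Suc j" using out countdown_inject[OF e(1) j(1), of "d - i" "Suc j"] by simp
    then show ?case using j(3) by (simp add: diff_Suc)
  qed (use e in simp)
  from run[of d] have out: "out (v + d) = countdown K e 0" by simp
  have "Suc (v + d) < n" using e v by simp
  from steps_or_guesses[OF cor this] have "inp (v + d) = e"
    unfolding in_steps_iff in_guesses_iff out
    using countdown_gt[of e 0] countdown_inject[OF e(1), of _ 0] by auto
  moreover have "inp (v + d) \<noteq> e"
  proof -
    have "secret (inp 0) \<le> 1" by (simp add: secret_def)
    then have "out (v + d) \<noteq> secret (inp 0)" using countdown_gt[of e 0] unfolding out by linarith
    then obtain e' d' where "e' < K" "out (v + d) = countdown K e' d'"
      "v + d + d' < n \<longrightarrow> inp (v + d + d') \<noteq> e'"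
      using inv[of "v + d"] e v by (auto simp: false_report_def)
    then show ?thesis using out countdown_inject[OF e(1), of e' 0 d'] e v by auto
  qed
  ultimately show False by simp
qed

text \<open>Propagating the secret is correct on every input, valid or not; this makes the problem
  solvable in all cases.\<close>

lemma correct_secret:
  assumes inp: "\<forall>v<n. inp v < K"
  shows "correct_output tiling_lcl n inp (\<lambda>_. secret (inp 0))"
proof -
  have "secret a \<le> 2" for a by (simp add: secret_def)
  with inp show ?thesis
    unfolding correct_output_iff in_outputs_iff in_first_labels_iff in_steps_iff by auto
qed

section \<open>Reporting a violation\<close>

definition violation :: "(nat \<Rightarrow> nat) \<Rightarrow> nat \<Rightarrow> nat \<Rightarrow> nat \<Rightarrow> bool" where
  "violation w n v d \<longleftrightarrow> v + d < n \<and>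
     (v = 0 \<and> 1 \<le> d \<and> d \<le> B \<and> w d \<noteq> start (d - 1) \<or>
      v \<ge> 1 \<and> d = B \<and> \<not> R (w (v - 1)) (w v) (w (v + 1)) (w (v + B)))"

text \<open>Node \<open>v\<close> reports the letter at \<open>v + d\<close>; nodes before it assert
  the secret and nodes behind the letter are released.\<close>

definition report :: "(nat \<Rightarrow> nat) \<Rightarrow> nat \<Rightarrow> nat \<Rightarrow> nat \<Rightarrow> nat" where
  "report w v d i = (if i < v then secret (w 0)
     else if i \<le> v + d then countdown K (w (v + d)) (v + d - i) else 2)"

lemma ex_violation: "\<not> valid_word w n \<Longrightarrow> \<exists>v d. violation w n v d"
proof -
  assume "\<not> valid_word w n"
  then consider j where "j < B" "Suc j < n" "w (Suc j) \<noteq> start j"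
    | v where "v \<ge> 1" "v + B < n" "\<not> R (w (v - 1)) (w v) (w (v + 1)) (w (v + B))"
    unfolding valid_word_def by blast
  then show ?thesis
  proof cases
    case (1 j)
    then have "violation w n 0 (Suc j)" by (simp add: violation_def)
    then show ?thesis by blast
  next
    case (2 v)
    then have "violation w n v B" by (simp add: violation_def)
    then show ?thesis by blast
  qed
qed

lemma correct_report:
  assumes B: "B \<ge> 1" and inp: "\<forall>v<n. inp v < K" and vio: "violation inp n v d"
  shows "correct_output tiling_lcl n inp (report inp v d)"
proof -
  \<comment> \<open>\<open>B \<ge> 1\<close> yields \<open>1 \<le> d\<close> in the second case of a
    violation, so the reporting node is never the last one.\<close>
  have vd: "v + d < n" "1 \<le> d" "d \<le> B" using vio B by (auto simp: violation_def)
  then have n: "n \<ge> 2" by simp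
  have w: "inp (v + d) < K" using vd inp by simp
  have out: "report inp v d i \<in> set (outputs K B)" if "i < n" for i
  proof -
    have "secret (inp 0) \<le> 2" by (simp add: secret_def)
    moreover have "v + d - i \<le> B" if "\<not> i < v" using that vd by simp
    ultimately show ?thesis using w by (auto simp: report_def in_outputs_iff)
  qed
  have first: "(inp 0, report inp v d 0) \<in> set first_labels"
  proof (cases "v = 0")
    case True
    then obtain j where d: "d = Suc j" using vd by (cases d) auto
    have "j < B" "inp (Suc j) < K" "inp (Suc j) \<noteq> start j"
      using vio True d w by (auto simp: violation_def)
    then show ?thesis unfolding in_first_labels_iff using True inp n d by (auto simp: report_def)
  next
    case False
    then show ?thesis unfolding in_first_labels_iff using inp n by (simp add: report_def)
  qed
  have step: "((inp u, report inp v d u), (inp (Suc u), report inp v d (Suc u))) \<in> set steps \<or>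
      Suc (Suc u) < n \<and>
      ((inp u, report inp v d u), (inp (Suc u), report inp v d (Suc u)), inp (Suc (Suc u))) \<in> set guesses"
    if u: "Suc u < n" for u
  proof -
    have sec: "secret (inp 0) \<le> 1" by (simp add: secret_def)
    have K: "inp u < K" "inp (Suc u) < K" using u inp by auto
    consider "Suc u < v" | "Suc u = v" | "v \<le> u" "u < v + d" | "u = v + d" | "u > v + d" by linarith
    then show ?thesis
    proof cases
      case 1
      then show ?thesis using sec K by (simp add: in_steps_iff report_def)
    next
      case 2
      then have "d = B" and notR: "\<not> R (inp u) (inp (Suc u)) (inp (Suc (Suc u))) (inp (v + B))"
        using vio by (auto simp: violation_def)
      then have "Suc (Suc u) < n" using vd 2 B by simp
      then show ?thesis using 2 notR sec K w inp \<open>d = B\<close> by (auto simp: in_guesses_iff report_def)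
    next
      case 3
      then have "v + d - u = Suc (v + d - Suc u)" "v + d - Suc u < B" using vd by auto
      then show ?thesis using 3 K w by (auto simp: in_steps_iff report_def)
    next
      case 4
      then show ?thesis using K by (auto simp: in_steps_iff report_def)
    next
      case 5
      then show ?thesis using K by (auto simp: in_steps_iff report_def)
    qed
  qed
  show ?thesis unfolding correct_output_iff
  proof (intro allI impI conjI)
    fix u assume u: "u < n"
    then show "report inp v d u \<in> set (outputs K B)" by (rule out)
    show "if n = 1 then inp 0 < K \<and> report inp v d 0 = secret (inp 0)
     else if u = 0 then
       (inp 0, report inp v d 0) \<in> set first_labels \<and> inp 1 < K \<and> report inp v d 1 \<in> set (outputs K B)
     else if Suc u = n then
       ((inp (u - 1), report inp v d (u - 1)), (inp u, report inp v d u)) \<in> set steps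
     else inp (Suc u) < K \<and> report inp v d (Suc u) \<in> set (outputs K B) \<and>
       (((inp (u - 1), report inp v d (u - 1)), (inp u, report inp v d u)) \<in> set steps \<or>
        ((inp (u - 1), report inp v d (u - 1)), (inp u, report inp v d u), inp (Suc u)) \<in> set guesses)"
      using n u first out inp step[of "u - 1"] by (cases u) auto
  qed
qed

lemma solvable_tiling_lcl: "solvable c tiling_lcl"
  unfolding solvable_def
proof (intro allI impI)
  fix n :: nat assume n: "n \<ge> 1"
  \<comment> \<open>With radius \<open>n\<close> every view starts at the first node, so entry 0 is
    the letter that carries the secret.\<close>
  have "solves_in c tiling_lcl (\<lambda>n (l, i). secret (snd (l ! 0))) n n"
    unfolding solves_in_def
  proof (intro allI impI)
    fix ids inp assume "valid_ids c n ids \<and> (\<forall>v<n. inp v \<in> set (in_labels tiling_lcl))"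
    then have inp: "\<forall>v<n. inp v < K" by (simp add: tiling_lcl_def)
    have "(case local_view n ids inp n v of (l, i) \<Rightarrow> secret (snd (l ! 0))) = secret (inp 0)"
      if "v < n" for v
    proof -
      have "[v - n..<min n (Suc (v + n))] = 0 # [1..<n]"
        using that n by (simp add: upt_conv_Cons)
      then show ?thesis by (simp add: local_view_def)
    qed
    then show "correct_output tiling_lcl n inp
       (\<lambda>v. case local_view n ids inp n v of (l, i) \<Rightarrow> secret (snd (l ! 0)))"
      by (intro correct_output_cong[OF correct_secret[OF inp]])
  qed
  then show "\<exists>t A. solves_in c tiling_lcl A n t" by blast
qed

text \<open>Indistinguishability: a node farther than \<open>t\<close> from the first one has the
  same view for first letters 0 and 1, but both words are valid and force different outputs
  there.\<close>

lemma solves_in_lower_bound: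
  assumes c: "c \<ge> 1" and K: "K \<ge> 2" and w: "\<And>v. w v < K"
    and val: "\<And>a n. a < K \<Longrightarrow> valid_word (w(0 := a)) n"
    and sol: "solves_in c tiling_lcl A n t"
  shows "n \<le> t + B + 2"
proof (rule ccontr)
  assume n: "\<not> n \<le> t + B + 2"
  \<comment> \<open>The last node to which \<open>secret_forced\<close> applies.\<close>
  define m where "m = n - B - 2"
  have m: "t < m" "m + B + 1 < n" using n by (auto simp: m_def)
  \<comment> \<open>Positions themselves serve as identifiers; they fit below \<open>n ^ c\<close>
    because \<open>c \<ge> 1\<close>.\<close>
  have "n ^ 1 \<le> n ^ c" using c n by (intro power_increasing) auto
  then have ids: "valid_ids c n id" by (auto simp: valid_ids_def)
  have *: "A n (local_view n id (w(0 := a)) t m) = secret a" if "a < K" for a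
  proof -
    have "\<forall>v<n. (w(0 := a)) v \<in> set (in_labels tiling_lcl)" using w that by (simp add: tiling_lcl_def)
    then have "correct_output tiling_lcl n (w(0 := a)) (\<lambda>v. A n (local_view n id (w(0 := a)) t v))"
      using sol ids unfolding solves_in_def by blast
    from secret_forced[OF this val[OF that] m(2)] show ?thesis by simp
  qed
  have "local_view n id (w(0 := 0)) t m = local_view n id (w(0 := 1)) t m"
    using m by (auto simp: local_view_def)
  then have "secret 0 = secret 1" using *[of 0] *[of 1] K by simp
  then show False by (simp add: secret_def)
qed

lemma linear_time_tiling_lcl:
  assumes c: "c \<ge> 1" and K: "K \<ge> 2" and w: "\<And>v. w v < K"
    and val: "\<And>a n. a < K \<Longrightarrow> valid_word (w(0 := a)) n"
  shows "enc_lcl tiling_lcl \<in> linear_time_lcls c"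
proof -
  have lb: "n \<le> time_complexity c tiling_lcl n + B + 2" if "n \<ge> 1" for n
  proof -
    have "\<exists>t A. solves_in c tiling_lcl A n t"
      using solvable_tiling_lcl that unfolding solvable_def by blast
    then have "\<exists>A. solves_in c tiling_lcl A n (time_complexity c tiling_lcl n)"
      unfolding time_complexity_def by (rule LeastI_ex)
    then show ?thesis using solves_in_lower_bound[OF c K w val] by blast
  qed
  have "(\<lambda>n. real n) \<in> O(\<lambda>n. real (time_complexity c tiling_lcl n))"
  \<comment> \<open>For \<open>n \<ge> 2 * B + 4\<close> the additive term \<open>B + 2\<close> is
    at most half of \<open>n\<close>, whence the factor 2.\<close>
  proof (rule landau_o.bigI[of 2])
    show "eventually (\<lambda>n. norm (real n) \<le> 2 * norm (real (time_complexity c tiling_lcl n))) at_top"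
      using eventually_ge_at_top[of "2 * B + 4"]
    proof eventually_elim
      case (elim n)
      then show ?case using lb[of n] by simp
    qed
  qed simp
  then have "(\<lambda>n. real (time_complexity c tiling_lcl n)) \<in> \<Omega>(\<lambda>n. real n)"
    by (simp add: bigomega_iff_bigo)
  then show ?thesis
    using solvable_tiling_lcl valid_tiling_lcl K unfolding linear_time_lcls_def by fastforce
qed

text \<open>Every word breaks a condition among its first \<open>N\<close> letters. Nodes in that
  prefix see all of it and agree on one violation; all later nodes lie behind the reported letter
  and answer 2. Paths shorter than \<open>N\<close> do not affect the asymptotics.\<close>

lemma constant_time_tiling_lcl:
  assumes B: "B \<ge> 1" and K: "K \<ge> 1"
    and inv: "\<And>w. (\<And>v. w v < K) \<Longrightarrow> \<not> valid_word w N"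
  shows "enc_lcl tiling_lcl \<in> constant_time_lcls c"
proof -
  define prefix where "prefix l u = (if u < N then l ! u else 0)" for l :: "nat list" and u
  \<comment> \<open>A choice that depends on the prefix alone makes all nodes report the same
    violation.\<close>
  define choice where "choice w = (SOME p. violation w N (fst p) (snd p))" for w
  \<comment> \<open>The index of node \<open>v\<close> in its radius-\<open>N\<close> view is the
    minimum of \<open>v\<close> and \<open>N\<close>: below \<open>N\<close> it is the true
    position, and otherwise it tells that the node lies outside the prefix.\<close>
  define A where "A n p = (if snd p < N
     then let w = prefix (map snd (fst p)) in report w (fst (choice w)) (snd (choice w)) (snd p)
     else 2)" for n :: nat and p :: view
  have "solves_in c tiling_lcl A n N" if n: "n \<ge> N" for n
    unfolding solves_in_def
  proof (intro allI impI)
    fix ids inp assume "valid_ids c n ids \<and> (\<forall>v<n. inp v \<in> set (in_labels tiling_lcl))"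
    then have inp: "\<forall>v<n. inp v < K" by (simp add: tiling_lcl_def)
    define w where "w u = (if u < N then inp u else 0)" for u
    define v where "v = fst (choice w)"
    define d where "d = snd (choice w)"
    \<comment> \<open>Padding with the letter 0, available because \<open>K \<ge> 1\<close>, turns
      the prefix into a word to which \<open>inv\<close> applies.\<close>
    have "\<not> valid_word w N" using inp n K by (intro inv) (auto simp: w_def)
    from ex_violation[OF this] have vio: "violation w N v d"
      unfolding v_def d_def choice_def by (intro someI_ex[of "\<lambda>p. violation w N (fst p) (snd p)"]) auto
    then have vd: "v + d < N" by (simp add: violation_def)
    \<comment> \<open>The violation reads positions below \<open>N\<close> only, where
      \<open>w\<close> and \<open>inp\<close> agree; \<open>v + 1\<close> is among them because
      \<open>B \<ge> 1\<close>.\<close>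
    have vio': "violation inp n v d"
      using vio n B by (auto simp: violation_def w_def split: if_splits)
    have "A n (local_view n ids inp N i) = report inp v d i" if i: "i < n" for i
    proof (cases "i < N")
      case True
      have "prefix (map snd (fst (local_view n ids inp N i))) = w"
        using True n by (auto simp: prefix_def w_def local_view_def fun_eq_iff)
      moreover have "snd (local_view n ids inp N i) = i"
        using True by (simp add: local_view_def)
      ultimately have "A n (local_view n ids inp N i) = report w v d i"
        using True by (simp add: A_def v_def d_def Let_def)
      also have "\<dots> = report inp v d i"
        using vd True by (simp add: report_def w_def)
      finally show ?thesis .
    next
      case False
      then show ?thesis using vd by (simp add: A_def local_view_def report_def)
    qed
    then show "correct_output tiling_lcl n inp (\<lambda>v. A n (local_view n ids inp N v))"
      by (intro correct_output_cong[OF correct_report[OF B inp vio']])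
  qed
  then have ub: "time_complexity c tiling_lcl n \<le> N" if "n \<ge> N" for n
    using that unfolding time_complexity_def by (intro Least_le) blast
  have "(\<lambda>n. real (time_complexity c tiling_lcl n)) \<in> O(\<lambda>_. 1)"
  proof (rule landau_o.bigI[of "real N + 1"])
    show "eventually (\<lambda>n. norm (real (time_complexity c tiling_lcl n)) \<le> (real N + 1) * norm (1 :: real)) at_top"
      using eventually_ge_at_top[of N]
    proof eventually_elim
      case (elim n)
      then show ?case using ub[of n] by simp
    qed
  qed simp
  then show ?thesis
    using solvable_tiling_lcl valid_tiling_lcl[OF K] unfolding constant_time_lcls_def by fastforce
qed

end


section \<open>Computations as locally checkable words\<close>

text \<open>A configuration is laid out as a word with one letter for every cell index.  Each letter repeats
  the state and the symbols scanned by all heads, so that a multi-tape step becomes a local rule; the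
  scanned symbols are guessed by the word and checked where the heads are.\<close>

datatype column = Column (leftmost: bool) (state: nat) (scanned: "nat list")
  (content: "nat list") (heads: "bool list")

definition columns :: "tm \<Rightarrow> column set" where
  "columns M = {u. state u < num_states M \<and>
     scanned u \<in> {s. set s \<subseteq> {..<num_symbols M} \<and> length s = num_tapes M} \<and>
     content u \<in> {s. set s \<subseteq> {..<num_symbols M} \<and> length s = num_tapes M} \<and>
     heads u \<in> {h. set h \<subseteq> UNIV \<and> length h = num_tapes M}}"

lemma finite_columns: "finite (columns M)"
proof -
  let ?W = "{s. set s \<subseteq> {..<num_symbols M} \<and> length s = num_tapes M}"
  let ?H = "{h :: bool list. set h \<subseteq> UNIV \<and> length h = num_tapes M}"
  have "columns M \<subseteq> (\<lambda>(l, q, s, c, h). Column l q s c h) ` (UNIV \<times> {..<num_states M} \<times> ?W \<times> ?W \<times> ?H)"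
  proof
    fix u assume "u \<in> columns M"
    then show "u \<in> (\<lambda>(l, q, s, c, h). Column l q s c h) ` (UNIV \<times> {..<num_states M} \<times> ?W \<times> ?W \<times> ?H)"
      by (intro image_eqI[of _ _ "(leftmost u, state u, scanned u, content u, heads u)"])
        (auto simp: columns_def)
  qed
  moreover have "finite ?W" "finite ?H"
    by (intro finite_lists_length_eq; simp)+
  ultimately show ?thesis by (meson finite_SigmaI finite_UNIV finite_imageI finite_lessThan finite_subset)
qed

definition column_at :: "config \<Rightarrow> nat \<Rightarrow> column" where
  "column_at c j = Column (j = 0) (fst c) (map read_tape (snd c))
     (map (\<lambda>(cells, pos). cells j) (snd c)) (map (\<lambda>(cells, pos). pos = j) (snd c))"

lemma column_at_sel [simp]:
  "leftmost (column_at c j) \<longleftrightarrow> j = 0"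
  "state (column_at c j) = fst c"
  "scanned (column_at c j) = map read_tape (snd c)"
  "content (column_at c j) = map (\<lambda>(cells, pos). cells j) (snd c)"
  "heads (column_at c j) = map (\<lambda>(cells, pos). pos = j) (snd c)"
  by (simp_all add: column_at_def)

text \<open>A halted machine rewrites the scanned symbols and keeps its heads in place.\<close>

definition column_action :: "tm \<Rightarrow> column \<Rightarrow> nat \<Rightarrow> nat \<times> move" where
  "column_action M u i = (if state u \<in> {1, 2} then (scanned u ! i, Stay)
     else snd (delta M (state u) (scanned u)) ! i)"

definition next_state :: "tm \<Rightarrow> column \<Rightarrow> nat" where
  "next_state M u = (if state u \<in> {1, 2} then state u else fst (delta M (state u) (scanned u)))"

definition next_content :: "tm \<Rightarrow> column \<Rightarrow> nat \<Rightarrow> nat" where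
  "next_content M u i = (if heads u ! i then fst (column_action M u i) else content u ! i)"

text \<open>The action is taken from \<open>u\<close> even for heads on the neighbours, since a
  block shares its state and scanned symbols. The flags mask neighbours that belong to another
  configuration and handle a left move in cell 0.\<close>

definition next_head :: "tm \<Rightarrow> column \<Rightarrow> column \<Rightarrow> column \<Rightarrow> nat \<Rightarrow> bool" where
  "next_head M l u r i = (case snd (column_action M u i) of
     Left \<Rightarrow> heads r ! i \<and> \<not> leftmost r \<or> heads u ! i \<and> leftmost u
   | Stay \<Rightarrow> heads u ! i
   | Right \<Rightarrow> heads l ! i \<and> \<not> leftmost u)"

text \<open>The symbols \<open>scanned u'\<close> remain free, because three adjacent columns cannot
  show what all heads will scan next. \<open>consistent\<close> determines them afterwards.\<close>

definition follows :: "tm \<Rightarrow> column \<Rightarrow> column \<Rightarrow> column \<Rightarrow> column \<Rightarrow> bool" where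
  "follows M l u r u' \<longleftrightarrow> leftmost u' = leftmost u \<and> state u' = next_state M u \<and>
     content u' = map (next_content M u) [0..<num_tapes M] \<and>
     heads u' = map (next_head M l u r) [0..<num_tapes M]"

definition consistent :: "tm \<Rightarrow> column \<Rightarrow> column \<Rightarrow> bool" where
  "consistent M l u \<longleftrightarrow>
     (\<not> leftmost u \<longrightarrow> state l = state u \<and> scanned l = scanned u) \<and>
     (\<forall>i<num_tapes M. heads u ! i \<longrightarrow> content u ! i = scanned u ! i)"

definition column_rule :: "tm \<Rightarrow> column \<Rightarrow> column \<Rightarrow> column \<Rightarrow> column \<Rightarrow> bool" where
  "column_rule M l u r u' \<longleftrightarrow> state u \<noteq> 1 \<and> consistent M l u \<and> follows M l u r u'"

definition good_config :: "tm \<Rightarrow> config \<Rightarrow> bool" where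
  "good_config M c \<longleftrightarrow> fst c < num_states M \<and> length (snd c) = num_tapes M \<and>
     (\<forall>i<num_tapes M. \<forall>j. fst (snd c ! i) j < num_symbols M)"

lemma step_eq:
  assumes "\<not> halted c"
  shows "step M c = (fst (delta M (fst c) (map read_tape (snd c))),
     map2 act_tape (snd (delta M (fst c) (map read_tape (snd c)))) (snd c))"
  using assms by (simp add: step_def split_beta)

lemma good_delta:
  assumes "valid_tm M" "good_config M c"
  shows "fst (delta M (fst c) (map read_tape (snd c))) < num_states M"
    and "length (snd (delta M (fst c) (map read_tape (snd c)))) = num_tapes M"
    and "i < num_tapes M \<Longrightarrow> fst (snd (delta M (fst c) (map read_tape (snd c))) ! i) < num_symbols M"
proof -
  let ?s = "map read_tape (snd c)"
  have "fst (snd c ! i) j < num_symbols M" if "i < num_tapes M" for i j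
    using assms(2) that by (simp add: good_config_def)
  then have read: "read_tape (snd c ! i) < num_symbols M" if "i < num_tapes M" for i
    using that by (cases "snd c ! i") (metis fst_conv read_tape.simps)
  have "set ?s \<subseteq> {..<num_symbols M}"
  proof (intro subsetI)
    fix a assume "a \<in> set ?s"
    then obtain i where "i < length (snd c)" "a = read_tape (snd c ! i)"
      unfolding in_set_conv_nth by auto
    with read assms(2) show "a \<in> {..<num_symbols M}" by (simp add: good_config_def)
  qed
  moreover have "fst c < num_states M" "length ?s = num_tapes M"
    using assms(2) by (auto simp: good_config_def)
  ultimately have *: "fst (delta M (fst c) ?s) < num_states M \<and>
        length (snd (delta M (fst c) ?s)) = num_tapes M \<and>
        fst ` set (snd (delta M (fst c) ?s)) \<subseteq> {..<num_symbols M}"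
    using assms(1) unfolding valid_tm_def by blast
  then show "fst (delta M (fst c) ?s) < num_states M"
    "length (snd (delta M (fst c) ?s)) = num_tapes M" by blast+
  show "fst (snd (delta M (fst c) ?s) ! i) < num_symbols M" if "i < num_tapes M"
    using * that nth_mem[of i "snd (delta M (fst c) ?s)"] by (auto simp: image_subset_iff)
qed

lemma good_step:
  assumes M: "valid_tm M" and c: "good_config M c"
  shows "good_config M (step M c)"
proof (cases "halted c")
  case False
  note d = good_delta[OF M c]
  have len: "length (snd c) = num_tapes M" using c by (simp add: good_config_def)
  have "fst (act_tape (snd (delta M (fst c) (map read_tape (snd c))) ! i) (snd c ! i)) j < num_symbols M"
    if "i < num_tapes M" for i j
  proof -
    obtain a m where a: "snd (delta M (fst c) (map read_tape (snd c))) ! i = (a, m)" by fastforce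
    obtain cells pos where tp: "snd c ! i = (cells, pos)" by fastforce
    have "cells j < num_symbols M" using c that tp by (metis fst_conv good_config_def)
    then show ?thesis using d(3)[OF that] a tp by simp
  qed
  then show ?thesis
    using d(1,2) len unfolding good_config_def step_eq[OF False] by simp
qed (use c in \<open>simp add: step_def\<close>)

lemma run_Suc: "run M x (Suc t) = step M (run M x t)"
  by (simp add: run_def)

lemma init_config_tapes:
  "i < num_tapes M \<Longrightarrow> snd (init_config M x) ! i = (word_cells (if i = 0 then x else []) , 0)"
  by (auto simp: init_config_def nth_Cons split: nat.splits)

lemma word_cells_less: "word_cells x j < 4"
  by (simp add: word_cells_def bit_symbol_def)

lemma good_run:
  assumes M: "valid_tm M"
  shows "good_config M (run M x t)"
proof (induction t)
  case 0
  have "num_symbols M \<ge> 4" "num_states M \<ge> 3" "num_tapes M \<ge> 1" using M by (auto simp: valid_tm_def)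
  moreover have "word_cells y j < num_symbols M" for y j
    using \<open>num_symbols M \<ge> 4\<close> word_cells_less[of y j] by simp
  moreover have "fst (init_config M x) = 0" "length (snd (init_config M x)) = Suc (num_tapes M - 1)"
    by (auto simp: init_config_def)
  ultimately show ?case
    by (simp add: good_config_def run_def init_config_tapes)
qed (simp add: run_Suc good_step[OF M])

lemma column_at_in_columns: "valid_tm M \<Longrightarrow> good_config M c \<Longrightarrow> column_at c j \<in> columns M"
proof -
  assume M: "valid_tm M" and c: "good_config M c"
  have "fst (snd c ! i) j < num_symbols M" if "i < num_tapes M" for i j
    using c that by (simp add: good_config_def)
  then have "(case tp of (cells, pos) \<Rightarrow> cells j) < num_symbols M" if "tp \<in> set (snd c)" for tp j
    using that c by (cases tp) (auto simp: good_config_def in_set_conv_nth, metis fst_conv)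
  moreover from this have "read_tape tp < num_symbols M" if "tp \<in> set (snd c)" for tp
    using that by (cases tp) fastforce
  ultimately show ?thesis using c by (auto simp: columns_def good_config_def)
qed

text \<open>The equivalence serves both directions: it forces the next block of a valid word, and it
  verifies the word built from a run. At the right end of a block \<open>r\<close> starts the next
  one; only its flag \<open>leftmost\<close> matters there.\<close>

lemma follows_column_at:
  assumes M: "valid_tm M" and c: "good_config M c"
    and l: "j > 0 \<Longrightarrow> l = column_at c (j - 1)"
    and r: "r = column_at c (Suc j) \<or> leftmost r \<and> (\<forall>i<num_tapes M. snd (snd c ! i) \<noteq> Suc j)"
  shows "follows M l (column_at c j) r u' \<longleftrightarrow> leftmost u' = (j = 0) \<and> state u' = fst (step M c) \<and>
    content u' = content (column_at (step M c) j) \<and> heads u' = heads (column_at (step M c) j)"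
proof -
  let ?u = "column_at c j" and ?d = "delta M (fst c) (map read_tape (snd c))"
  have len: "length (snd c) = num_tapes M" "length (snd (step M c)) = num_tapes M"
    using c good_step[OF M c] by (auto simp: good_config_def)
  note d = good_delta[OF M c]
  have state: "next_state M ?u = fst (step M c)"
    by (auto simp: next_state_def step_def halted_def split_beta)
  have act: "snd (step M c) ! i = act_tape (column_action M ?u i) (snd c ! i)"
    if i: "i < num_tapes M" for i
  proof (cases "halted c")
    case True
    then show ?thesis using i len
      by (cases "snd c ! i") (simp add: column_action_def step_def halted_def)
  next
    case False
    then have "column_action M ?u i = snd ?d ! i"
      by (simp add: column_action_def halted_def)
    then show ?thesis using i len d(2) by (simp add: step_eq[OF False])
  qed
  have "map (next_content M ?u) [0..<num_tapes M] = content (column_at (step M c) j)"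
  proof (rule nth_equalityI)
    fix i assume "i < length (map (next_content M ?u) [0..<num_tapes M])"
    then have i: "i < num_tapes M" by simp
    obtain cells pos where tp: "snd c ! i = (cells, pos)" by (cases "snd c ! i")
    obtain a m where am: "column_action M ?u i = (a, m)" by (cases "column_action M ?u i")
    show "map (next_content M ?u) [0..<num_tapes M] ! i = content (column_at (step M c) j) ! i"
      using i len act[OF i] tp am by (auto simp: next_content_def)
  qed (use len in simp)
  moreover have "map (next_head M l ?u r) [0..<num_tapes M] = heads (column_at (step M c) j)"
  proof (rule nth_equalityI)
    fix i assume "i < length (map (next_head M l ?u r) [0..<num_tapes M])"
    then have i: "i < num_tapes M" by simp
    obtain cells pos where tp: "snd c ! i = (cells, pos)" by (cases "snd c ! i")
    obtain a m where am: "column_action M ?u i = (a, m)" by (cases "column_action M ?u i")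
    have r': "heads r ! i \<and> \<not> leftmost r \<longleftrightarrow> pos = Suc j"
      using r i len tp by auto
    have l': "heads l ! i \<and> j \<noteq> 0 \<longleftrightarrow> Suc pos = j"
      using l i len tp by (cases j) auto
    have "next_head M l ?u r i \<longleftrightarrow> (case m of Left \<Rightarrow> pos - 1 | Stay \<Rightarrow> pos | Right \<Rightarrow> Suc pos) = j"
      unfolding next_head_def am snd_conv r' using l' i len tp by (cases m) auto
    then show "map (next_head M l ?u r) [0..<num_tapes M] ! i = heads (column_at (step M c) j) ! i"
      using i len act[OF i] tp am by simp
  qed (use len in simp)
  ultimately show ?thesis unfolding follows_def state by simp
qed

lemma consistent_column_at:
  assumes "good_config M c" "j > 0 \<Longrightarrow> l = column_at c (j - 1)"
  shows "consistent M l (column_at c j)"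
proof -
  have "content (column_at c j) ! i = scanned (column_at c j) ! i"
    if "i < num_tapes M" "heads (column_at c j) ! i" for i
    using that assms(1) by (cases "snd c ! i") (auto simp: good_config_def)
  then show ?thesis using assms(2) by (auto simp: consistent_def)
qed

lemma column_eqI:
  "leftmost u = leftmost v \<Longrightarrow> state u = state v \<Longrightarrow> scanned u = scanned v \<Longrightarrow>
   content u = content v \<Longrightarrow> heads u = heads v \<Longrightarrow> u = v"
  by (cases u; cases v) simp

text \<open>The guessed symbols are constant along the block, and each head is at some cell of the
  block, where its guess is compared with the content. \<open>L j\<close> is the letter preceding
  \<open>W j\<close>; the one preceding the block is arbitrary.\<close>

lemma block_determined:
  assumes c: "good_config M c" and pos: "\<And>i. i < num_tapes M \<Longrightarrow> snd (snd c ! i) < B"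
    and core: "\<And>j. j < B \<Longrightarrow> leftmost (W j) = (j = 0) \<and> state (W j) = fst c \<and>
      content (W j) = content (column_at c j) \<and> heads (W j) = heads (column_at c j)"
    and cols: "\<And>j. j < B \<Longrightarrow> W j \<in> columns M"
    and con: "\<And>j. j < B \<Longrightarrow> consistent M (L j) (W j)" and L: "\<And>j. Suc j < B \<Longrightarrow> L (Suc j) = W j"
    and j: "j < B"
  shows "W j = column_at c j"
proof -
  have len: "length (snd c) = num_tapes M" using c by (simp add: good_config_def)
  have scan: "scanned (W j) = scanned (W 0)" if "j < B" for j
    using that
  proof (induction j)
    case (Suc j)
    then show ?case using con[of "Suc j"] core[of "Suc j"] L[of j] by (simp add: consistent_def)
  qed simp
  have "scanned (W 0) ! i = map read_tape (snd c) ! i" if i: "i < num_tapes M" for i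
  proof -
    obtain cells p where tp: "snd c ! i = (cells, p)" by (cases "snd c ! i")
    have p: "p < B" using pos[OF i] tp by simp
    have "heads (W p) ! i" using core[OF p] i len tp by simp
    then have "content (W p) ! i = scanned (W p) ! i" using con[OF p] i by (simp add: consistent_def)
    then show ?thesis using scan[OF p] core[OF p] i len tp by simp
  qed
  moreover have "length (scanned (W 0)) = num_tapes M" using cols[of 0] j by (simp add: columns_def)
  ultimately have "scanned (W 0) = map read_tape (snd c)" using len by (intro nth_equalityI) auto
  then show ?thesis using core[OF j] scan[OF j] by (intro column_eqI) auto
qed

text \<open>A function of the input symbol \<open>a\<close> alone: \<open>a = 1\<close> identifies
  cell 0, and there all heads stand on markers. One tape test therefore gives the program the whole
  column.\<close>

definition initial_column :: "tm \<Rightarrow> nat \<Rightarrow> column" where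
  "initial_column M a = Column (a = 1) 0 (replicate (num_tapes M) 1)
     (a # replicate (num_tapes M - 1) (if a = 1 then 1 else 0)) (replicate (num_tapes M) (a = 1))"

lemma initial_column_word_cells:
  assumes "valid_tm M"
  shows "initial_column M (word_cells x j) = column_at (run M x 0) j"
proof -
  have k: "num_tapes M \<ge> 1" using assms by (simp add: valid_tm_def)
  have "word_cells [] j = (if j = 0 then 1 else 0)" by (simp add: word_cells_def)
  moreover have "replicate (num_tapes M) b = b # replicate (num_tapes M - 1) b" for b :: bool
    using k by (cases "num_tapes M") auto
  moreover have "replicate (num_tapes M) b = b # replicate (num_tapes M - 1) b" for b :: nat
    using k by (cases "num_tapes M") auto
  moreover have "word_cells x 0 = 1" "word_cells [] 0 = 1" by (simp_all add: word_cells_def)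
  moreover have "j = 0 \<and> word_cells x j = 1 \<or> j \<noteq> 0 \<and> word_cells x j \<noteq> 1"
    by (auto simp: word_cells_def bit_symbol_def)
  ultimately show ?thesis
    unfolding initial_column_def column_at_def run_def init_config_def
    by (auto simp del: replicate_Suc)
qed

section \<open>Valid words and runs of the machine\<close>

locale machine_tiling =
  fixes M :: tm and code :: "column \<Rightarrow> nat" and K :: nat
  assumes M: "valid_tm M" and code: "bij_betw code (columns M) {..<K}"
begin

text \<open>Numbers from \<open>K\<close> on are decoded arbitrarily.\<close>

definition decode :: "nat \<Rightarrow> column" where
  "decode = inv_into (columns M) code"

lemma decode_code [simp]: "u \<in> columns M \<Longrightarrow> decode (code u) = u"
  using code by (simp add: decode_def bij_betw_def)

lemma code_less: "u \<in> columns M \<Longrightarrow> code u < K"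
  using code by (auto simp: bij_betw_def)

lemma decode_in_columns: "a < K \<Longrightarrow> decode a \<in> columns M"
  using code unfolding decode_def by (metis bij_betw_def inv_into_into lessThan_iff)

definition rule :: "nat \<Rightarrow> nat \<Rightarrow> nat \<Rightarrow> nat \<Rightarrow> bool" where
  "rule a b b' e = column_rule M (decode a) (decode b) (decode b') (decode e)"

definition initial :: "nat \<Rightarrow> nat" where
  "initial a = code (initial_column M a)"

text \<open>The flag \<open>leftmost\<close> already distinguishes the columns of cells 0 and
  1.\<close>

lemma K_ge_2: "K \<ge> 2"
proof -
  let ?u = "\<lambda>j. column_at (run M [] 0) j"
  have "?u 0 \<in> columns M" "?u 1 \<in> columns M"
    using column_at_in_columns[OF M good_run[OF M]] by blast+
  moreover have "?u 0 \<noteq> ?u 1"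
    by (metis column_at_sel(1) zero_neq_one)
  ultimately have "code (?u 0) \<noteq> code (?u 1)" "code (?u 0) < K" "code (?u 1) < K"
    using code_less decode_code by metis+
  then show ?thesis by linarith
qed

context
  fixes x :: "bool list" and B :: nat
  assumes space: "\<And>t i. i < num_tapes M \<Longrightarrow> snd (snd (run M x t) ! i) < B"
begin

interpretation tiling K B "\<lambda>j. initial (word_cells x j)" rule .

lemma B_pos: "B \<ge> 1"
proof -
  have "num_tapes M \<ge> 1" using M by (simp add: valid_tm_def)
  then show ?thesis using space[of 0 0] by linarith
qed

text \<open>Block \<open>t\<close> of a valid word occupies the positions from
  \<open>Suc (t * B)\<close> on and must spell out configuration \<open>t\<close>; at time
  \<open>T\<close> this puts state 1 where the rule forbids it.\<close>

lemma accepting_no_valid_word: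
  assumes acc: "fst (run M x T) = 1"
  shows "\<exists>N. \<forall>w. (\<forall>v. w v < K) \<longrightarrow> \<not> valid_word w N"
proof (intro exI allI impI notI)
  \<comment> \<open>The length has room for blocks 0 to \<open>T\<close> and for the further block
    at which the rule for block \<open>T\<close> looks.\<close>
  fix w assume w: "\<forall>v. w v < K" and val: "valid_word w ((T + 2) * B + 2)"
  define W where "W v = decode (w v)" for v
  have cols: "W v \<in> columns M" for v using w by (simp add: W_def decode_in_columns)
  have rule: "column_rule M (W (v - 1)) (W v) (W (v + 1)) (W (v + B))"
    if "v \<ge> 1" "v + B < (T + 2) * B + 2" for v
    using val that unfolding valid_word_def rule_def W_def by blast
  have block: "v + B < (T + 2) * B + 2" if "v = Suc (t * B + j)" "j < B" "t \<le> T" for v t j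
  proof -
    have "t * B \<le> T * B" using that(3) by (rule mult_le_mono1)
    moreover have "(T + 2) * B = T * B + 2 * B" by (rule add_mult_distrib)
    ultimately show ?thesis using that(1,2) by linarith
  qed
  have exact: "W (Suc (t * B + j)) = column_at (run M x t) j"
    if core: "\<And>j. j < B \<Longrightarrow> leftmost (W (Suc (t * B + j))) = (j = 0) \<and>
      state (W (Suc (t * B + j))) = fst (run M x t) \<and>
      content (W (Suc (t * B + j))) = content (column_at (run M x t) j) \<and>
      heads (W (Suc (t * B + j))) = heads (column_at (run M x t) j)"
      and t: "t \<le> T" and j: "j < B" for t j
  proof (rule block_determined[where M = M and B = B and W = "\<lambda>j. W (Suc (t * B + j))" and L = "\<lambda>j. W (t * B + j)"])
    show "consistent M (W (t * B + j)) (W (Suc (t * B + j)))" if "j < B" for j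
      using rule[of "Suc (t * B + j)"] block[OF refl that t] by (simp add: column_rule_def)
  qed (use core j cols space good_run[OF M] in auto)
  have "\<forall>j<B. W (Suc (t * B + j)) = column_at (run M x t) j" if "t \<le> T" for t
    using that
  proof (induction t)
    case 0
    have "W (Suc j) = column_at (run M x 0) j" if "j < B" for j
    proof -
      have "Suc j < (T + 2) * B + 2" using that by simp
      then have "w (Suc j) = initial (word_cells x j)"
        using val that unfolding valid_word_def by blast
      then show ?thesis
        using column_at_in_columns[OF M good_run[OF M]]
        by (simp add: W_def initial_def initial_column_word_cells[OF M])
    qed
    then show ?case by simp
  next
    case (Suc t)
    then have IH: "W (Suc (t * B + j)) = column_at (run M x t) j" if "j < B" for j
      using that by simp
    have t: "t \<le> T" using Suc by simp
    \<comment> \<open>The last column of block \<open>t\<close> has the first letter of block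
      \<open>t + 1\<close> as right neighbour, which is not yet identified. Its flag is already
      fixed by the rule at the start of block \<open>t\<close>, and this breaks the circle.\<close>
    have left: "leftmost (W (Suc (Suc t * B)))"
    proof -
      have "follows M (W (t * B)) (W (Suc (t * B))) (W (Suc (Suc (t * B)))) (W (Suc (t * B) + B))"
        using rule[of "Suc (t * B)"] block[of "Suc (t * B)" t 0] t B_pos by (simp add: column_rule_def)
      then show ?thesis using IH[of 0] B_pos by (simp add: follows_def add.commute)
    qed
    have "leftmost (W (Suc (Suc t * B + j))) = (j = 0) \<and>
      state (W (Suc (Suc t * B + j))) = fst (run M x (Suc t)) \<and>
      content (W (Suc (Suc t * B + j))) = content (column_at (run M x (Suc t)) j) \<and>
      heads (W (Suc (Suc t * B + j))) = heads (column_at (run M x (Suc t)) j)" if j: "j < B" for j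
    proof -
      let ?v = "Suc (t * B + j)"
      have "follows M (W (?v - 1)) (W ?v) (W (?v + 1)) (W (?v + B))"
        using rule[of ?v] block[OF refl j t] by (simp add: column_rule_def)
      then have fol: "follows M (W (?v - 1)) (column_at (run M x t) j) (W (?v + 1)) (W (?v + B))"
        using IH[OF j] by simp
      have l: "W (?v - 1) = column_at (run M x t) (j - 1)" if "j > 0"
        using IH[of "j - 1"] that j by simp
      have r: "W (?v + 1) = column_at (run M x t) (Suc j) \<or>
        leftmost (W (?v + 1)) \<and> (\<forall>i<num_tapes M. snd (snd (run M x t) ! i) \<noteq> Suc j)"
      proof (cases "Suc j < B")
        case True
        then show ?thesis using IH[of "Suc j"] by simp
      next
        case False
        then have "B = Suc j" using j by simp
        then have "?v + 1 = Suc (Suc t * B)" by simp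
        moreover have "snd (snd (run M x t) ! i) \<noteq> Suc j" if "i < num_tapes M" for i
          using space[OF that, of t] \<open>B = Suc j\<close> by simp
        ultimately show ?thesis using left by metis
      qed
      have "leftmost (W (?v + B)) = (j = 0) \<and> state (W (?v + B)) = fst (step M (run M x t)) \<and>
         content (W (?v + B)) = content (column_at (step M (run M x t)) j) \<and>
         heads (W (?v + B)) = heads (column_at (step M (run M x t)) j)"
        by (rule iffD1[OF follows_column_at[OF M good_run[OF M] l r] fol])
      moreover have "?v + B = Suc (Suc t * B + j)" by simp
      ultimately show ?thesis by (metis run_Suc)
    qed
    then show ?case using exact Suc.prems by blast
  qed
  from this[of T] have "W (Suc (T * B)) = column_at (run M x T) 0" using B_pos by fastforce
  moreover have "state (W (Suc (T * B))) \<noteq> 1"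
    using rule[of "Suc (T * B)"] block[of "Suc (T * B)" T 0] B_pos by (simp add: column_rule_def)
  ultimately show False using acc by simp
qed

text \<open>Writing down all configurations one after another obeys the rule forever, since a halted
  configuration is followed by itself.\<close>

lemma rejecting_valid_word:
  assumes rej: "\<And>t. fst (run M x t) \<noteq> 1"
  shows "\<exists>w. (\<forall>v. w v < K) \<and> (\<forall>a<K. \<forall>N. valid_word (w(0 := a)) N)"
proof -
  define u where "u t j = column_at (run M x t) j" for t j
  have u: "u t j \<in> columns M" for t j
    unfolding u_def by (rule column_at_in_columns[OF M good_run[OF M]])
  \<comment> \<open>Blocks start at position 1; position 0 receives some letter only to be
    overwritten by \<open>a\<close>.\<close>
  define w where "w v = code (u ((v - 1) div B) ((v - 1) mod B))" for v
  have "valid_word (w(0 := a)) N" if a: "a < K" for a N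
    unfolding valid_word_def
  proof (intro conjI allI impI)
    fix j assume "j < B"
    then show "(w(0 := a)) (Suc j) = initial (word_cells x j)"
      by (simp add: w_def u_def initial_def initial_column_word_cells[OF M])
  next
    fix v :: nat assume v: "1 \<le> v"
    define t where "t = (v - 1) div B"
    define j where "j = (v - 1) mod B"
    have j: "j < B" using B_pos by (simp add: j_def)
    have vtj: "v - 1 = t * B + j" by (simp add: t_def j_def)
    have wu: "decode ((w(0 := a)) (Suc (t * B + j))) = u t j" if "j < B" for t j
      using that u by (simp add: w_def)
    have v': "v = Suc (t * B + j)" "v + B = Suc (Suc t * B + j)" using vtj v by auto
    \<comment> \<open>For \<open>j = 0\<close> the letter on the left belongs to the previous block
      or is the secret; the rule at a leftmost column does not depend on it.\<close>
    have "decode ((w(0 := a)) (v - 1)) = u t (j - 1)" if "j > 0"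
      using wu[of "j - 1" t] that j v' by simp
    moreover have "decode ((w(0 := a)) (v + 1)) = u t (Suc j) \<or>
        leftmost (decode ((w(0 := a)) (v + 1))) \<and> (\<forall>i<num_tapes M. snd (snd (run M x t) ! i) \<noteq> Suc j)"
    proof (cases "Suc j < B")
      case True
      then show ?thesis using wu[of "Suc j" t] v' by simp
    next
      case False
      then have B: "B = Suc j" using j by simp
      then have "v + 1 = Suc (Suc t * B + 0)" using v' by simp
      then have "decode ((w(0 := a)) (v + 1)) = u (Suc t) 0" using wu[of 0 "Suc t"] B_pos by (metis Suc_le_lessD One_nat_def)
      moreover have "snd (snd (run M x t) ! i) \<noteq> Suc j" if "i < num_tapes M" for i
        using space[OF that, of t] B by simp
      ultimately show ?thesis by (simp add: u_def)
    qed
    ultimately have "consistent M (decode ((w(0 := a)) (v - 1))) (u t j)"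
      "follows M (decode ((w(0 := a)) (v - 1))) (u t j) (decode ((w(0 := a)) (v + 1))) (u (Suc t) j)"
      using consistent_column_at[OF good_run[OF M], of j _ x t] follows_column_at[OF M good_run[OF M], of j _ x t]
      unfolding u_def by (auto simp: run_Suc)
    then have "column_rule M (decode ((w(0 := a)) (v - 1))) (u t j) (decode ((w(0 := a)) (v + 1))) (u (Suc t) j)"
      using rej[of t] by (simp add: column_rule_def u_def)
    moreover have "decode ((w(0 := a)) v) = u t j" "decode ((w(0 := a)) (v + B)) = u (Suc t) j"
      unfolding v'(2) using wu[OF j, of t] wu[OF j, of "Suc t"] v'(1) by (simp_all only:)
    ultimately show "rule ((w(0 := a)) (v - 1)) ((w(0 := a)) v) ((w(0 := a)) (v + 1)) ((w(0 := a)) (v + B))"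
      by (simp add: rule_def)
  qed
  moreover have "w v < K" for v using u code_less by (simp add: w_def)
  ultimately show ?thesis by blast
qed

end

end

lemma machine_tiling_exists:
  assumes "valid_tm M"
  shows "\<exists>code K. machine_tiling M code K"
  using ex_bij_betw_finite_nat[OF finite_columns] assms
  unfolding machine_tiling_def atLeast0LessThan by blast


section \<open>A program for the reduction\<close>

text \<open>Input labels, arcs and the centre are fixed text; only output labels can involve
  \<open>B\<close> and hence registers.\<close>

definition emit_graph :: "(nat \<times> lin) list \<Rightarrow> (nat \<times> nat) list \<Rightarrow> nat \<Rightarrow> com" where
  "emit_graph ls as v =
     Seq (Emit True) (Seq (seqs (map (\<lambda>(a, e). Seq (emits (True # enc_nat a)) (emit_lin e)) ls))
       (emits (False # enc_list enc_pair as @ enc_nat v)))"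

definition enc_items :: "graph_desc list \<Rightarrow> bool list" where
  "enc_items gs = concat (map (\<lambda>g. True # enc_graph g) gs)"

lemma enc_items_append: "enc_items (gs @ hs) = enc_items gs @ enc_items hs"
  by (simp add: enc_items_def)

lemma enc_items_concat: "enc_items (concat (map f xs)) = concat (map (\<lambda>x. enc_items (f x)) xs)"
  by (induction xs) (simp_all add: enc_items_def)

lemma enc_items_map: "enc_items (map f xs) = concat (map (\<lambda>x. enc_items [f x]) xs)"
  by (simp add: enc_items_def comp_def)

lemma enc_lcl_items:
  "enc_lcl P = enc_list enc_nat (in_labels P) @ concat (map (\<lambda>z. True # enc_nat z) (out_labels P)) @
     False # enc_nat (radius P) @ enc_items (allowed P) @ [False]"
  by (simp add: enc_lcl_def enc_list_def enc_items_def)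

lemma enc_graph_node_labels:
  "enc_items [\<lparr>node_labels = map (\<lambda>(a, e). (a, f e)) ls, arc_list = as, centre_node = v\<rparr>] =
    True # concat (map (\<lambda>p. case p of (a, e) \<Rightarrow> (True # enc_nat a) @ enc_nat (f e)) ls) @
      False # enc_list enc_pair as @ enc_nat v"
proof -
  have "concat (map (\<lambda>x. True # enc_pair x) (map (\<lambda>(a, e). (a, f e)) ls)) =
     concat (map (\<lambda>p. case p of (a, e) \<Rightarrow> (True # enc_nat a) @ enc_nat (f e)) ls)"
    by (induction ls) (auto simp: enc_pair_def)
  then show ?thesis by (simp add: enc_items_def enc_graph_def enc_list_def)
qed

lemma concat_concat: "concat (concat xs) = concat (map concat xs)"
  by (induction xs) simp_all

lemma countdown_0: "countdown K e 0 = 3 + e"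
  by (simp add: countdown_def)

lemma generates_Emit: "generates (Emit b) S (\<lambda>x B h. [b])"
  by (rule generatesI[where T = "\<lambda>_. 1"]) (auto intro: poly_bounded_intros execs_Emit[unfolded One_nat_def])

lemma generates_emit_graph:
  assumes "\<And>a e. (a, e) \<in> set ls \<Longrightarrow> snd (snd e) < 3"
  shows "generates (emit_graph ls as v) S (\<lambda>x B h. enc_items
    [\<lparr>node_labels = map (\<lambda>(a, e). (a, lin_val h e)) ls, arc_list = as, centre_node = v\<rparr>])"
proof -
  have "generates (case p of (a, e) \<Rightarrow> Seq (emits (True # enc_nat a)) (emit_lin e)) S
     (\<lambda>x B h. case p of (a, e) \<Rightarrow> (True # enc_nat a) @ enc_nat (lin_val h e))" if "p \<in> set ls" for p
  proof -
    obtain a e where p: "p = (a, e)" by (cases p)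
    have "generates (Seq (emits (True # enc_nat a)) (emit_lin e)) S
      (\<lambda>x B h. (True # enc_nat a) @ enc_nat (lin_val h e))"
      by (rule generates_Seq[OF generates_emits generates_emit_lin]) (use assms that p in auto)
    then show ?thesis by (simp add: p)
  qed
  note body = this
  show ?thesis unfolding emit_graph_def
    by (rule generates_cong,
        (rule generates_Seq generates_Emit generates_seqs body generates_emits | assumption)+)
      (simp only: enc_graph_node_labels append_Cons append_Nil)
qed

text \<open>The letters \<open>e\<close> are unrolled into the program and only the length is a
  loop: \<open>countdown K e (Suc j)\<close> is \<open>3 + e + K\<close> plus \<open>K\<close> times
  \<open>j\<close>. Factor 0 turns a triple into a constant.\<close>

definition for_outputs :: "nat \<Rightarrow> nat \<Rightarrow> (lin \<Rightarrow> com) \<Rightarrow> com" where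
  "for_outputs K v body = Seq (seqs (map (\<lambda>a. body (a, 0, 2)) ([0, 1, 2] @ map (\<lambda>e. 3 + e) [0..<K])))
     (for_each v (seqs (map (\<lambda>e. body (3 + e + K, K, v)) [0..<K])))"

text \<open>The invariance of \<open>F\<close> says that the loop variable enters the text only
  through the label, so texts from different rounds can be compared at the same
  \<open>h\<close>.\<close>

lemma generates_for_outputs:
  assumes v: "v \<in> S" "S \<subseteq> {0, 1}"
    and body: "\<And>e. snd (snd e) \<in> {v, 2} \<Longrightarrow> generates (body e) (S - {v}) (\<lambda>x B h. F (lin_val h e) x B h)"
    and F: "\<And>z x B h i j. F z x B (h(v := i, 3 + v := j)) = F z x B h"
  shows "generates (for_outputs K v body) S (\<lambda>x B h. concat (map (\<lambda>z. F z x B h) (outputs K B)))"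
proof -
  have "generates (body (a, 0, 2)) S (\<lambda>x B h. F a x B h)" for a
    using generates_mono[OF body[of "(a, 0, 2)"], of S] by (simp add: lin_val_def)
  note 1 = this
  have 2: "generates (body (3 + e + K, K, v)) (S - {v}) (\<lambda>x B h. F (countdown K e (Suc (h v))) x B h)" for e
    using body[of "(3 + e + K, K, v)"] by (simp add: lin_val_def countdown_def ac_simps)
  show ?thesis
    unfolding for_outputs_def
    by (rule generates_cong, (rule generates_Seq generates_seqs generates_for_each 1 2 v)+)
      (simp add: F outputs_def countdown_0 map_concat concat_concat comp_def)
qed

text \<open>Cell \<open>j\<close> holds one of the symbols 0 to 3, so the condition
  \<open>e \<noteq> start j\<close> becomes finitely many tests: emission is suppressed at the
  symbols \<open>s\<close> with \<open>ini s = e\<close>.\<close>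

definition for_first_labels :: "nat \<Rightarrow> (nat \<Rightarrow> nat) \<Rightarrow> (nat \<Rightarrow> lin \<Rightarrow> com) \<Rightarrow> com" where
  "for_first_labels K ini body = Seq (seqs (map (\<lambda>a. body a (secret a, 0, 2)) [0..<K]))
     (for_each 0 (seqs (map (\<lambda>a. seqs (map (\<lambda>e.
       unless_sym (filter (\<lambda>s. ini s = e) [0..<4]) (body a (3 + e + K, K, 0))) [0..<K])) [0..<K])))"

lemma concat_map_filter: "concat (map f (filter Q xs)) = concat (map (\<lambda>x. if \<not> Q x then [] else f x) xs)"
  by (induction xs) auto

lemma generates_for_first_labels:
  assumes S: "0 \<in> S" "S \<subseteq> {0, 1}"
    and body: "\<And>a e. snd (snd e) \<in> {0, 2} \<Longrightarrow>
      generates (body a e) (S - {0}) (\<lambda>x B h. F (a, lin_val h e) x B h)"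
    and F: "\<And>z x B h i j. F z x B (h(0 := i, 3 := j)) = F z x B h"
  shows "generates (for_first_labels K ini body) S
    (\<lambda>x B h. concat (map (\<lambda>z. F z x B h) (tiling.first_labels K B (\<lambda>j. ini (word_cells x j)))))"
proof -
  have "generates (body a (secret a, 0, 2)) S (\<lambda>x B h. F (a, secret a) x B h)" for a
    using generates_mono[OF body[of "(secret a, 0, 2)"], of S] by (simp add: lin_val_def)
  note 1 = generates_seqs[OF this]
  have "generates (body a (3 + e + K, K, 0)) (S - {0}) (\<lambda>x B h. F (a, countdown K e (Suc (h 0))) x B h)" for a e
    using body[of "(3 + e + K, K, 0)" a] by (simp add: lin_val_def countdown_def ac_simps)
  note 2 = generates_for_each[OF generates_seqs[OF generates_seqs[OF generates_unless_sym[OF this]]] S]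
  show ?thesis
    unfolding for_first_labels_def
  proof (rule generates_cong[OF generates_Seq[OF 1 2]])
    fix x B and h :: "nat \<Rightarrow> nat"
    have "word_cells x j \<in> set (filter (\<lambda>s. ini s = e) [0..<4]) \<longleftrightarrow> e = ini (word_cells x j)" for j e
      using word_cells_less[of x j] by auto
    moreover have "h(0 := i, 3 + 0 := j) = h(0 := i, 3 := j)" for i j by simp
    ultimately show "concat (map (\<lambda>a. F (a, secret a) x B h) [0..<K]) @
       concat (map (\<lambda>j. concat (map (\<lambda>a. concat (map (\<lambda>e.
         if word_cells x ((h(0 := j, 3 + 0 := B - j)) 0) \<in> set (filter (\<lambda>s. ini s = e) [0..<4]) then []
         else F (a, countdown K e (Suc ((h(0 := j, 3 + 0 := B - j)) 0))) x B (h(0 := j, 3 + 0 := B - j)))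
           [0..<K])) [0..<K])) [0..<B]) =
       concat (map (\<lambda>z. F z x B h) (tiling.first_labels K B (\<lambda>j. ini (word_cells x j))))"
      by (simp add: F tiling.first_labels_def map_concat concat_concat comp_def concat_map_filter
          if_distrib[of concat] if_distrib[of "map _"] cong: if_cong del: set_filter)
  qed
qed

text \<open>Consecutive lengths \<open>Suc j\<close> and \<open>j\<close> come from the same loop
  variable, with offsets that differ by \<open>K\<close>.\<close>

definition for_steps :: "nat \<Rightarrow> (nat \<Rightarrow> lin \<Rightarrow> nat \<Rightarrow> lin \<Rightarrow> com) \<Rightarrow> com" where
  "for_steps K body =
     Seq (seqs (map (\<lambda>a. seqs (map (\<lambda>b. seqs (map (\<lambda>s. body a (s, 0, 2) b (s, 0, 2)) [0, 1, 2])) [0..<K])) [0..<K]))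
      (Seq (seqs (map (\<lambda>a. seqs (map (\<lambda>b. body a (countdown K a 0, 0, 2) b (2, 0, 2)) [0..<K])) [0..<K]))
        (for_each 0 (seqs (map (\<lambda>a. seqs (map (\<lambda>b. seqs (map (\<lambda>e.
          body a (3 + e + K, K, 0) b (3 + e, K, 0)) [0..<K])) [0..<K])) [0..<K]))))"

lemma generates_for_steps:
  assumes S: "0 \<in> S" "S \<subseteq> {0, 1}"
    and body: "\<And>a e b f. snd (snd e) \<in> {0, 2} \<Longrightarrow> snd (snd f) \<in> {0, 2} \<Longrightarrow>
      generates (body a e b f) (S - {0}) (\<lambda>x B h. F ((a, lin_val h e), (b, lin_val h f)) x B h)"
    and F: "\<And>z x B h i j. F z x B (h(0 := i, 3 := j)) = F z x B h"
  shows "generates (for_steps K body) S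
    (\<lambda>x B h. concat (map (\<lambda>z. F z x B h) (tiling.steps K B)))"
proof -
  have const: "generates (body a (y, 0, 2) b (z, 0, 2)) S (\<lambda>x B h. F ((a, y), (b, z)) x B h)" for a b y z
    using generates_mono[OF body[of "(y, 0, 2)" "(z, 0, 2)"], of S] by (simp add: lin_val_def)
  have var: "generates (body a (3 + e + K, K, 0) b (3 + e, K, 0)) (S - {0})
     (\<lambda>x B h. F ((a, countdown K e (Suc (h 0))), (b, countdown K e (h 0))) x B h)" for a b e
    using body[of "(3 + e + K, K, 0)" "(3 + e, K, 0)" a b] by (simp add: lin_val_def countdown_def ac_simps)
  show ?thesis
    unfolding for_steps_def
    by (rule generates_cong, (rule generates_Seq generates_seqs generates_for_each const var S)+)
      (simp add: F tiling.steps_def map_concat concat_concat comp_def)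
qed

text \<open>\<open>R\<close> is evaluated when the program is composed, not when it runs. All these
  countdowns have length \<open>B\<close>, read from register 2.\<close>

definition for_guesses ::
  "nat \<Rightarrow> (nat \<Rightarrow> nat \<Rightarrow> nat \<Rightarrow> nat \<Rightarrow> bool) \<Rightarrow> (nat \<Rightarrow> lin \<Rightarrow> nat \<Rightarrow> lin \<Rightarrow> nat \<Rightarrow> com) \<Rightarrow> com" where
  "for_guesses K R body = seqs (map (\<lambda>a. seqs (map (\<lambda>b. seqs (map (\<lambda>b'. seqs (map (\<lambda>e.
     seqs (map (\<lambda>s. body a (s, 0, 2) b (3 + e, K, 2) b') [0, 1]))
       (filter (\<lambda>e. \<not> R a b b' e) [0..<K]))) [0..<K])) [0..<K])) [0..<K])"

lemma generates_for_guesses: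
  assumes body: "\<And>a e b f b'. snd (snd e) = 2 \<Longrightarrow> snd (snd f) = 2 \<Longrightarrow>
      generates (body a e b f b') S (\<lambda>x B h. F ((a, lin_val h e), (b, lin_val h f), b') x B h)"
  shows "generates (for_guesses K R body) S
    (\<lambda>x B h. concat (map (\<lambda>z. F z x B h) (tiling.guesses K B R)))"
proof -
  have const: "generates (body a (s, 0, 2) b (3 + e, K, 2) b') S
     (\<lambda>x B h. F ((a, s), (b, 3 + e + K * h 2), b') x B h)" for a b b' e s
    using body[of "(s, 0, 2)" "(3 + e, K, 2)" a b b'] by (simp add: lin_val_def)
  show ?thesis
    unfolding for_guesses_def
    by (rule generates_cong, (rule generates_seqs const)+)
      (simp add: tiling.guesses_def map_concat concat_concat comp_def ready_def countdown_def)
qed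


lemma generates_emit_path1:
  assumes "snd (snd e) < 3"
  shows "generates (emit_graph [(a, e)] [] 0) S (\<lambda>x B h. enc_items [path1 (a, lin_val h e)])"
  by (rule generates_cong, rule generates_emit_graph) (use assms in \<open>auto simp: path1_def\<close>)

lemma generates_emit_path2:
  assumes "snd (snd e) < 3" "snd (snd f) < 3"
  shows "generates (emit_graph [(a, e), (b, f)] [(0, 1)] v) S
    (\<lambda>x B h. enc_items [path2 v (a, lin_val h e) (b, lin_val h f)])"
  by (rule generates_cong, rule generates_emit_graph) (use assms in \<open>auto simp: path2_def\<close>)

lemma generates_emit_path3:
  assumes "snd (snd e) < 3" "snd (snd f) < 3" "snd (snd g) < 3"
  shows "generates (emit_graph [(a, e), (b, f), (c, g)] [(0, 1), (1, 2)] 1) S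
    (\<lambda>x B h. enc_items [path3 (a, lin_val h e) (b, lin_val h f) (c, lin_val h g)])"
  by (rule generates_cong, rule generates_emit_graph) (use assms in \<open>auto simp: path3_def\<close>)

text \<open>The order is that of \<open>enc_lcl\<close> and of \<open>allowed\<close>, since the
  texts must agree literally. Outer loops use variable 0, whose tape also answers input tests;
  variable 1 runs through the output labels.\<close>

definition lcl_program :: "nat \<Rightarrow> (nat \<Rightarrow> nat) \<Rightarrow> (nat \<Rightarrow> nat \<Rightarrow> nat \<Rightarrow> nat \<Rightarrow> bool) \<Rightarrow> com" where
  "lcl_program K ini R =
     Seq (emits (enc_list enc_nat [0..<K]))
    (Seq (for_outputs K 1 (\<lambda>e. Seq (Emit True) (emit_lin e)))
    (Seq (emits (False # enc_nat 1))
    (Seq (seqs (map (\<lambda>a. emit_graph [(a, (secret a, 0, 2))] [] 0) [0..<K]))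
    (Seq (for_first_labels K ini (\<lambda>a e. for_outputs K 1 (\<lambda>f.
       seqs (map (\<lambda>b. emit_graph [(a, e), (b, f)] [(0, 1)] 0) [0..<K]))))
    (Seq (for_steps K (\<lambda>a e b f. emit_graph [(a, e), (b, f)] [(0, 1)] 1))
    (Seq (for_steps K (\<lambda>a e b f. for_outputs K 1 (\<lambda>g.
       seqs (map (\<lambda>c. emit_graph [(a, e), (b, f), (c, g)] [(0, 1), (1, 2)] 1) [0..<K]))))
    (Seq (for_guesses K R (\<lambda>a e b f c. for_outputs K 1 (\<lambda>g.
       emit_graph [(a, e), (b, f), (c, g)] [(0, 1), (1, 2)] 1)))
      (Emit False))))))))"

lemma generates_lcl_program:
  "generates (lcl_program K ini R) {0, 1}
    (\<lambda>x B h. enc_lcl (tiling.tiling_lcl K B (\<lambda>j. ini (word_cells x j)) R))"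
proof -
  \<comment> \<open>Labels fixed by an outer loop refer to registers 0 and 2, which the inner loop
    over variable 1 leaves unchanged.\<close>
  have lin_val_upd: "lin_val (h(1 := i, 3 + 1 := j)) e = lin_val h e" if "snd (snd e) \<in> {0, 2}" for e h i j
    using that by (auto simp: lin_val_def)
  have outs: "generates (for_outputs K 1 (\<lambda>e. Seq (Emit True) (emit_lin e))) {0, 1}
      (\<lambda>x B h. concat (map (\<lambda>z. True # enc_nat z) (outputs K B)))"
  proof (rule generates_for_outputs)
    show "generates (Seq (Emit True) (emit_lin e)) ({0, 1} - {1}) (\<lambda>x B h. True # enc_nat (lin_val h e))"
      if "snd (snd e) \<in> {1, 2}" for e
      by (rule generates_cong, rule generates_Seq[OF generates_Emit generates_emit_lin]) (use that in auto)
  qed auto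
  have singles: "generates (seqs (map (\<lambda>a. emit_graph [(a, (secret a, 0, 2))] [] 0) [0..<K])) {0, 1}
      (\<lambda>x B h. enc_items (map (\<lambda>a. path1 (a, secret a)) [0..<K]))"
    by (rule generates_cong, rule generates_seqs, rule generates_emit_path1)
      (simp_all add: lin_val_def enc_items_map[where xs = "[0..<K]"])
  have firsts: "generates (for_first_labels K ini (\<lambda>a e. for_outputs K 1 (\<lambda>f.
       seqs (map (\<lambda>b. emit_graph [(a, e), (b, f)] [(0, 1)] 0) [0..<K])))) {0, 1}
     (\<lambda>x B h. concat (map (\<lambda>p. concat (map (\<lambda>z. concat (map (\<lambda>b. enc_items [path2 0 p (b, z)]) [0..<K]))
        (outputs K B))) (tiling.first_labels K B (\<lambda>j. ini (word_cells x j)))))"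
  proof (rule generates_for_first_labels)
    fix a and e :: lin assume e: "snd (snd e) \<in> {0, 2}"
    show "generates (for_outputs K 1 (\<lambda>f. seqs (map (\<lambda>b. emit_graph [(a, e), (b, f)] [(0, 1)] 0) [0..<K])))
      ({0, 1} - {0}) (\<lambda>x B h. concat (map (\<lambda>z. concat (map (\<lambda>b. enc_items [path2 0 (a, lin_val h e) (b, z)]) [0..<K]))
        (outputs K B)))"
    proof (rule generates_for_outputs)
      show "generates (seqs (map (\<lambda>b. emit_graph [(a, e), (b, f)] [(0, 1)] 0) [0..<K])) ({0, 1} - {0} - {1})
        (\<lambda>x B h. concat (map (\<lambda>b. enc_items [path2 0 (a, lin_val h e) (b, lin_val h f)]) [0..<K]))"
        if "snd (snd f) \<in> {1, 2}" for f
        by (rule generates_seqs, rule generates_emit_path2) (use e that in auto)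
    qed (use e in \<open>auto simp: lin_val_upd[simplified]\<close>)
  qed auto
  have pairs: "generates (for_steps K (\<lambda>a e b f. emit_graph [(a, e), (b, f)] [(0, 1)] 1)) {0, 1}
     (\<lambda>x B h. concat (map (\<lambda>z. enc_items [path2 1 (fst z) (snd z)]) (tiling.steps K B)))"
  proof (rule generates_for_steps)
    show "generates (emit_graph [(a, e), (b, f)] [(0, 1)] 1) ({0, 1} - {0})
      (\<lambda>x B h. enc_items [path2 1 (fst ((a, lin_val h e), b, lin_val h f)) (snd ((a, lin_val h e), b, lin_val h f))])"
      if "snd (snd e) \<in> {0, 2}" "snd (snd f) \<in> {0, 2}" for a e b f
      unfolding fst_conv snd_conv by (rule generates_emit_path2) (use that in auto)
  qed auto
  have triples: "generates (for_steps K (\<lambda>a e b f. for_outputs K 1 (\<lambda>g.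
       seqs (map (\<lambda>c. emit_graph [(a, e), (b, f), (c, g)] [(0, 1), (1, 2)] 1) [0..<K])))) {0, 1}
     (\<lambda>x B h. concat (map (\<lambda>z. concat (map (\<lambda>y. concat (map (\<lambda>c.
        enc_items [path3 (fst z) (snd z) (c, y)]) [0..<K])) (outputs K B))) (tiling.steps K B)))"
  proof (rule generates_for_steps)
    fix a b and e f :: lin assume ef: "snd (snd e) \<in> {0, 2}" "snd (snd f) \<in> {0, 2}"
    show "generates (for_outputs K 1 (\<lambda>g.
       seqs (map (\<lambda>c. emit_graph [(a, e), (b, f), (c, g)] [(0, 1), (1, 2)] 1) [0..<K]))) ({0, 1} - {0})
      (\<lambda>x B h. concat (map (\<lambda>y. concat (map (\<lambda>c.
        enc_items [path3 (fst ((a, lin_val h e), b, lin_val h f)) (snd ((a, lin_val h e), b, lin_val h f)) (c, y)])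
          [0..<K])) (outputs K B)))"
      unfolding fst_conv snd_conv
    proof (rule generates_for_outputs)
      show "generates (seqs (map (\<lambda>c. emit_graph [(a, e), (b, f), (c, g)] [(0, 1), (1, 2)] 1) [0..<K]))
        ({0, 1} - {0} - {1})
        (\<lambda>x B h. concat (map (\<lambda>c. enc_items [path3 (a, lin_val h e) (b, lin_val h f) (c, lin_val h g)]) [0..<K]))"
        if "snd (snd g) \<in> {1, 2}" for g
        by (rule generates_seqs, rule generates_emit_path3) (use ef that in auto)
    qed (use ef in \<open>auto simp: lin_val_upd[simplified]\<close>)
  qed auto
  have guesses: "generates (for_guesses K R (\<lambda>a e b f c. for_outputs K 1 (\<lambda>g.
       emit_graph [(a, e), (b, f), (c, g)] [(0, 1), (1, 2)] 1))) {0, 1}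
     (\<lambda>x B h. concat (map (\<lambda>z. concat (map (\<lambda>y.
        enc_items [path3 (fst z) (fst (snd z)) (snd (snd z), y)]) (outputs K B))) (tiling.guesses K B R)))"
  proof (rule generates_for_guesses)
    fix a b c and e f :: lin assume ef: "snd (snd e) = 2" "snd (snd f) = 2"
    show "generates (for_outputs K 1 (\<lambda>g. emit_graph [(a, e), (b, f), (c, g)] [(0, 1), (1, 2)] 1)) {0, 1}
      (\<lambda>x B h. concat (map (\<lambda>y. enc_items [path3 (fst ((a, lin_val h e), (b, lin_val h f), c))
         (fst (snd ((a, lin_val h e), (b, lin_val h f), c)))
         (snd (snd ((a, lin_val h e), (b, lin_val h f), c)), y)]) (outputs K B)))"
      unfolding fst_conv snd_conv
    proof (rule generates_for_outputs)
      show "generates (emit_graph [(a, e), (b, f), (c, g)] [(0, 1), (1, 2)] 1) ({0, 1} - {1})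
        (\<lambda>x B h. enc_items [path3 (a, lin_val h e) (b, lin_val h f) (c, lin_val h g)])"
        if "snd (snd g) \<in> {1, 2}" for g
        by (rule generates_emit_path3) (use ef that in auto)
    qed (use ef in \<open>auto simp: lin_val_upd[simplified]\<close>)
  qed
  show ?thesis
    unfolding lcl_program_def
    by (rule generates_cong, (rule generates_Seq generates_emits outs singles firsts pairs triples guesses generates_Emit)+)
      (simp add: enc_lcl_items tiling.tiling_lcl_def enc_items_append enc_items_concat enc_items_map[of _ "[0..<K]"] enc_items_map[of _ "outputs K _"]
        enc_items_map[of _ "tiling.steps K _"] split_beta)
qed

section \<open>Computing the block length\<close>

definition regs :: "nat \<Rightarrow> nat \<Rightarrow> nat \<Rightarrow> nat \<Rightarrow> nat \<Rightarrow> nat \<Rightarrow> nat \<Rightarrow> nat" where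
  "regs a b c d e f i = (if i = 0 then a else if i = 1 then b else if i = 2 then c
     else if i = 3 then d else if i = 4 then e else if i = 5 then f else 0)"

text \<open>Several targets duplicate a counter, and an empty list of targets clears it.\<close>

definition transfer :: "nat \<Rightarrow> nat list \<Rightarrow> com" where
  "transfer v ws = WhileNe v 1 (seqs (Dec v # map Inc ws))"

lemma execs_incs:
  "distinct ws \<Longrightarrow>
   execs x (seqs (map Inc ws)) h y (Suc (2 * length ws)) (\<lambda>i. if i \<in> set ws then Suc (h i) else h i) y"
proof (induction ws arbitrary: h)
  case Nil
  then show ?case using execs_Skip by simp
next
  case (Cons w ws)
  have eq: "(\<lambda>i. if i \<in> set ws then Suc ((h(w := Suc (h w))) i) else (h(w := Suc (h w))) i) =
    (\<lambda>i. if i \<in> set (w # ws) then Suc (h i) else h i)"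
    using Cons.prems by (auto simp: fun_eq_iff)
  have "distinct ws" using Cons.prems by simp
  from execs_Seq[OF execs_Inc Cons.IH[OF this, of "h(w := Suc (h w))", unfolded eq]]
  show ?case by simp
qed

lemma execs_transfer:
  assumes ws: "distinct ws" "v \<notin> set ws" and n: "n = h v"
    and h': "h' = (\<lambda>i. if i = v then 0 else if i \<in> set ws then h i + n else h i)"
  shows "execs x (transfer v ws) h y (Suc (n * (2 * length ws + 4))) h' y"
proof -
  let ?H = "\<lambda>j i. if i = v then n - j else if i \<in> set ws then h i + j else h i"
  have body: "execs x (seqs (Dec v # map Inc ws)) (?H j) y (2 * length ws + 3) (?H (Suc j)) y"
    if j: "j < n" for j
  proof -
    have "(\<lambda>i. if i \<in> set ws then Suc (((?H j)(v := ?H j v - 1)) i) else ((?H j)(v := ?H j v - 1)) i)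
      = ?H (Suc j)"
      using ws j by (auto simp: fun_eq_iff)
    with execs_Seq[OF execs_Dec execs_incs[OF ws(1)], of x v "?H j" y]
    show ?thesis by (simp add: numeral_3_eq_3)
  qed
  have "execs x (transfer v ws) h y (Suc (n * Suc (2 * length ws + 3))) h' y"
    unfolding transfer_def
    by (rule execs_While[where H = "?H" and Y = "\<lambda>_. y", OF _ _ body])
      (use n h' in \<open>auto simp: tape_sym_eq_Suc_0_iff fun_eq_iff\<close>)
  then show ?thesis by (simp add: numeral_eq_Suc)
qed

text \<open>Each of the rounds counted by register 2 adds register 1 to register 3; register 4 takes
  a second copy, from which register 1 is restored.\<close>

definition multiply :: com where
  "multiply = Seq (WhileNe 2 1 (Seq (Dec 2) (Seq (transfer 1 [3, 4]) (transfer 4 [1])))) (transfer 3 [2])"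

lemma execs_multiply:
  "execs x multiply (regs 0 n c 0 0 0) y (20 * (c * n) + 10 * c + 10) (regs 0 n (c * n) 0 0 0) y"
proof -
  let ?H = "\<lambda>j. regs 0 n (c - j) (j * n) 0 0"
  have body: "execs x (Seq (Dec 2) (Seq (transfer 1 [3, 4]) (transfer 4 [1]))) (?H j) y (14 * n + 5) (?H (Suc j)) y"
    if j: "j < c" for j
  proof -
    have 1: "execs x (transfer 1 [3, 4]) (regs 0 n (c - Suc j) (j * n) 0 0) y (Suc (n * (2 * length [3::nat, 4] + 4)))
      (regs 0 0 (c - Suc j) (j * n + n) n 0) y"
      by (rule execs_transfer) (auto simp: regs_def fun_eq_iff)
    have 2: "execs x (transfer 4 [1]) (regs 0 0 (c - Suc j) (j * n + n) n 0) y (Suc (n * (2 * length [1::nat] + 4)))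
      (?H (Suc j)) y"
      by (rule execs_transfer) (auto simp: regs_def fun_eq_iff)
    have "(?H j)(2 := ?H j 2 - 1) = regs 0 n (c - Suc j) (j * n) 0 0"
      by (auto simp: regs_def fun_eq_iff)
    then have 0: "execs x (Dec 2) (?H j) y 1 (regs 0 n (c - Suc j) (j * n) 0 0) y"
      using execs_Dec[of x 2 "?H j" y] by simp
    show ?thesis
      using execs_Seq[OF 0 execs_Seq[OF 1 2]] by (rule execs_mono) simp
  qed
  have loop: "execs x (WhileNe 2 1 (Seq (Dec 2) (Seq (transfer 1 [3, 4]) (transfer 4 [1])))) (regs 0 n c 0 0 0) y
     (Suc (c * Suc (14 * n + 5))) (regs 0 n 0 (c * n) 0 0) y"
    by (rule execs_While[where H = "?H" and Y = "\<lambda>_. y", OF _ _ body])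
      (auto simp: tape_sym_eq_Suc_0_iff regs_def)
  have final: "execs x (transfer 3 [2]) (regs 0 n 0 (c * n) 0 0) y (Suc ((c * n) * (2 * length [2::nat] + 4)))
      (regs 0 n (c * n) 0 0 0) y"
    by (rule execs_transfer) (auto simp: regs_def fun_eq_iff)
  show ?thesis
    unfolding multiply_def using execs_Seq[OF loop final] by (rule execs_mono) (simp add: algebra_simps)
qed

fun horner :: "nat list \<Rightarrow> com" where
  "horner [] = Skip"
| "horner (a # as) = Seq (horner as) (Seq multiply (seqs (replicate a (Inc 2))))"

lemma execs_add_const:
  "execs x (seqs (replicate a (Inc 2))) (regs 0 n c 0 0 0) y (Suc (2 * a)) (regs 0 n (a + c) 0 0 0) y"
proof (induction a arbitrary: c)
  case 0
  then show ?case using execs_Skip by simp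
next
  case (Suc a)
  have "(regs 0 n c 0 0 0)(2 := Suc (regs 0 n c 0 0 0 2)) = regs 0 n (Suc c) 0 0 0"
    by (auto simp: regs_def fun_eq_iff)
  then have "execs x (Inc 2) (regs 0 n c 0 0 0) y 1 (regs 0 n (Suc c) 0 0 0) y"
    using execs_Inc[of x 2 "regs 0 n c 0 0 0" y] by simp
  from execs_Seq[OF this Suc[of "Suc c"]] show ?case by simp
qed

lemma execs_horner:
  "\<exists>T. poly_bounded T \<and> (\<forall>x n y. execs x (horner as) (regs 0 n 0 0 0 0) y (T n)
     (regs 0 n (poly (Poly as) n) 0 0 0) y)"
proof (induction as)
  case Nil
  show ?case
    by (rule exI[of _ "\<lambda>_. 1"]) (use execs_Skip in \<open>auto intro: poly_bounded_intros\<close>)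
next
  case (Cons a as)
  then obtain T where T: "poly_bounded T"
    "\<forall>x n y. execs x (horner as) (regs 0 n 0 0 0 0) y (T n) (regs 0 n (poly (Poly as) n) 0 0 0) y"
    by blast
  let ?c = "\<lambda>n. poly (Poly as) n"
  let ?T = "\<lambda>n. Suc (T n + Suc ((20 * (?c n * n) + 10 * ?c n + 10) + Suc (2 * a)))"
  have "execs x (horner (a # as)) (regs 0 n 0 0 0 0) y (?T n) (regs 0 n (poly (Poly (a # as)) n) 0 0 0) y" for x n y
  proof -
    have eq: "poly (Poly (a # as)) n = a + ?c n * n" by (simp add: mult.commute)
    show ?thesis
      unfolding eq horner.simps
      by (rule execs_Seq[OF T(2)[rule_format] execs_Seq[OF execs_multiply execs_add_const]])
  qed
  moreover have "poly_bounded ?T" by (intro poly_bounded_intros T(1))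
  ultimately show ?case by blast
qed

text \<open>The loop ends at the blank behind the word, in cell \<open>length x + 1\<close> because
  the marker takes cell 0; \<open>Dec 1\<close> makes up for this.\<close>

definition count_input :: com where
  "count_input = Seq (WhileNe 0 0 (Seq (Inc 0) (Inc 1))) (Seq (Dec 1) (transfer 0 []))"

lemma execs_count_input:
  "execs x count_input (regs 0 0 0 0 0 0) y (10 * length x + 20) (regs 0 (length x) 0 0 0 0) y"
proof -
  let ?H = "\<lambda>j. regs j j 0 0 0 0"
  have body: "execs x (Seq (Inc 0) (Inc 1)) (?H j) y 3 (?H (Suc j)) y" for j
  proof -
    have "((?H j)(0 := Suc (?H j 0)))(1 := Suc (((?H j)(0 := Suc (?H j 0))) 1)) = ?H (Suc j)"
      by (auto simp: regs_def fun_eq_iff)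
    then show ?thesis using execs_Seq[OF execs_Inc[of x 0 "?H j" y] execs_Inc[of x 1]]
      by (simp add: numeral_3_eq_3)
  qed
  have loop: "execs x (WhileNe 0 0 (Seq (Inc 0) (Inc 1))) (regs 0 0 0 0 0 0) y (Suc (Suc (length x) * Suc 3))
     (?H (Suc (length x))) y"
    by (rule execs_While[where H = "?H" and Y = "\<lambda>_. y", OF _ _ body])
      (auto simp: tape_sym_def tape_word_def word_cells_def bit_symbol_def regs_def)
  have "(?H (Suc (length x)))(1 := ?H (Suc (length x)) 1 - 1) = regs (Suc (length x)) (length x) 0 0 0 0"
    by (auto simp: regs_def fun_eq_iff)
  then have dec: "execs x (Dec 1) (?H (Suc (length x))) y 1 (regs (Suc (length x)) (length x) 0 0 0 0) y"
    using execs_Dec[of x 1 "?H (Suc (length x))" y] by simp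
  have rewind: "execs x (transfer 0 []) (regs (Suc (length x)) (length x) 0 0 0 0) y
     (Suc (Suc (length x) * (2 * length ([] :: nat list) + 4))) (regs 0 (length x) 0 0 0 0) y"
    by (rule execs_transfer) (auto simp: regs_def fun_eq_iff)
  show ?thesis
    unfolding count_input_def using execs_Seq[OF loop execs_Seq[OF dec rewind]] by (rule execs_mono) simp
qed

definition set_bound :: "nat poly \<Rightarrow> com" where
  "set_bound p = Seq count_input (Seq (horner (coeffs p)) (Seq (Inc 2)
     (Seq (transfer 1 []) (Seq (transfer 2 [3, 4, 5]) (transfer 5 [2])))))"

lemma execs_set_bound:
  "\<exists>T. poly_bounded T \<and> (\<forall>x. let B = Suc (poly p (length x)) in
     execs x (set_bound p) (\<lambda>_. 0) [] (T (length x)) (regs 0 0 B B B 0) [])"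
proof -
  obtain T where T: "poly_bounded T"
    "\<forall>x n y. execs x (horner (coeffs p)) (regs 0 n 0 0 0 0) y (T n) (regs 0 n (poly (Poly (coeffs p)) n) 0 0 0) y"
    using execs_horner by blast
  let ?T = "\<lambda>n. Suc ((10 * n + 20) + Suc (T n + Suc (1 + Suc (Suc (n * (2 * length ([] :: nat list) + 4)) +
    Suc (Suc (Suc (poly p n) * (2 * length [3::nat, 4, 5] + 4)) + Suc (Suc (poly p n) * (2 * length [2::nat] + 4)))))))"
  have "execs x (set_bound p) (\<lambda>_. 0) [] (?T (length x))
     (regs 0 0 (Suc (poly p (length x))) (Suc (poly p (length x))) (Suc (poly p (length x))) 0) []" for x
  proof -
    let ?n = "length x"
    let ?B = "Suc (poly p ?n)"
    have zero: "(\<lambda>_. 0) = regs 0 0 0 0 0 0" by (auto simp: regs_def fun_eq_iff)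
    have 2: "execs x (horner (coeffs p)) (regs 0 ?n 0 0 0 0) [] (T ?n) (regs 0 ?n (poly p ?n) 0 0 0) []"
      using T(2) by simp
    have "(regs 0 ?n (poly p ?n) 0 0 0)(2 := Suc (regs 0 ?n (poly p ?n) 0 0 0 2)) = regs 0 ?n ?B 0 0 0"
      by (auto simp: regs_def fun_eq_iff)
    then have 3: "execs x (Inc 2) (regs 0 ?n (poly p ?n) 0 0 0) [] 1 (regs 0 ?n ?B 0 0 0) []"
      using execs_Inc[of x 2 "regs 0 ?n (poly p ?n) 0 0 0" "[]"] by simp
    have 4: "execs x (transfer 1 []) (regs 0 ?n ?B 0 0 0) [] (Suc (?n * (2 * length ([] :: nat list) + 4)))
      (regs 0 0 ?B 0 0 0) []"
      by (rule execs_transfer) (auto simp: regs_def fun_eq_iff)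
    have 5: "execs x (transfer 2 [3, 4, 5]) (regs 0 0 ?B 0 0 0) [] (Suc (?B * (2 * length [3::nat, 4, 5] + 4)))
      (regs 0 0 0 ?B ?B ?B) []"
      by (rule execs_transfer) (auto simp: regs_def fun_eq_iff)
    have 6: "execs x (transfer 5 [2]) (regs 0 0 0 ?B ?B ?B) [] (Suc (?B * (2 * length [2::nat] + 4)))
      (regs 0 0 ?B ?B ?B 0) []"
      by (rule execs_transfer) (auto simp: regs_def fun_eq_iff)
    show ?thesis
      unfolding set_bound_def zero
      by (rule execs_Seq[OF execs_count_input execs_Seq[OF 2 execs_Seq[OF 3 execs_Seq[OF 4 execs_Seq[OF 5 6]]]]])
  qed
  moreover have "poly_bounded ?T" by (intro poly_bounded_intros T(1))
  ultimately show ?thesis unfolding Let_def by (intro exI[of _ ?T]) blast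
qed

lemma wf_transfer: "v < m \<Longrightarrow> \<forall>w\<in>set ws. w < m \<Longrightarrow> wf_com m (transfer v ws)"
  by (auto simp: transfer_def wf_seqs)

lemma wf_horner: "wf_com 6 (horner as)"
  by (induction as) (auto simp: multiply_def wf_transfer wf_seqs)

lemma wf_set_bound: "wf_com 6 (set_bound p)"
  by (simp add: set_bound_def count_input_def wf_horner wf_transfer)

lemma poly_time_computable_tiling_lcl:
  "poly_time_computable (\<lambda>x. enc_lcl (tiling.tiling_lcl K (Suc (poly p (length x))) (\<lambda>j. ini (word_cells x j)) R))"
  (is "poly_time_computable ?f")
proof -
  obtain T where T: "wf_com 6 (lcl_program K ini R)" "poly_bounded T"
    "\<forall>x B h y. ready {0, 1} B h \<longrightarrow> execs x (lcl_program K ini R) h y (T B) h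
       (y @ enc_lcl (tiling.tiling_lcl K B (\<lambda>j. ini (word_cells x j)) R))"
    using generates_lcl_program by (rule generatesE)
  obtain T' where T': "poly_bounded T'" "\<forall>x. let B = Suc (poly p (length x)) in
     execs x (set_bound p) (\<lambda>_. 0) [] (T' (length x)) (regs 0 0 B B B 0) []"
    using execs_set_bound by blast
  \<comment> \<open>The generator is polynomial in \<open>B\<close>, and \<open>B\<close> is
    polynomial in the length of the input.\<close>
  have "poly_bounded (\<lambda>n. Suc (T' n + T (Suc (poly p n))))"
    by (intro poly_bounded_intros T'(1) poly_bounded_compose[OF T(2)])
  then obtain q where q: "\<forall>n. Suc (T' n + T (Suc (poly p n))) \<le> poly q n"
    unfolding poly_bounded_def by blast
  show ?thesis
  proof (rule poly_time_computable_exec)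
    show "wf_com 6 (Seq (set_bound p) (lcl_program K ini R))" using T(1) wf_set_bound by simp
    fix x :: "bool list"
    let ?B = "Suc (poly p (length x))"
    have 1: "execs x (set_bound p) (\<lambda>_. 0) [] (T' (length x)) (regs 0 0 ?B ?B ?B 0) []"
      using T'(2)[rule_format, of x] by (simp add: Let_def)
    have "ready {0, 1} ?B (regs 0 0 ?B ?B ?B 0)" by (auto simp: ready_def regs_def)
    then have 2: "execs x (lcl_program K ini R) (regs 0 0 ?B ?B ?B 0) [] (T ?B) (regs 0 0 ?B ?B ?B 0) (?f x)"
      using T(3)[rule_format, of ?B _ x "[]"] by simp
    have "execs x (Seq (set_bound p) (lcl_program K ini R)) (\<lambda>_. 0) [] (poly q (length x))
       (regs 0 0 ?B ?B ?B 0) (?f x)"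
      using execs_Seq[OF 1 2] q[rule_format, of "length x"] by (rule execs_mono)
    then show "\<exists>t h. t \<le> poly q (length x) \<and>
       exec x (Seq (set_bound p) (lcl_program K ini R)) (\<lambda>_. 0) [] t h (?f x)"
      unfolding execs_def by blast
  qed simp
qed

lemma run_halted: "halted (run M x t) \<Longrightarrow> run M x (t + k) = run M x t"
  by (induction k) (simp_all add: run_Suc step_def)

theorem theorem5:
  fixes c :: nat
  assumes "c \<ge> 1"
  shows "PSPACE_hard_to_distinguish (constant_time_lcls c) (linear_time_lcls c)"
  unfolding PSPACE_hard_to_distinguish_def
proof
  fix L assume "L \<in> PSPACE"
  then obtain M and p :: "nat poly" where M: "valid_tm M"
    and dec: "\<And>x. \<exists>t. halted (run M x t) \<and> (fst (run M x t) = 1 \<longleftrightarrow> x \<in> L)"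
    and space: "\<And>x t. \<forall>(cells, pos) \<in> set (snd (run M x t)). pos \<le> poly p (length x)"
    unfolding PSPACE_def by blast
  obtain code K where mt: "machine_tiling M code K" using machine_tiling_exists[OF M] by blast
  interpret machine_tiling M code K by (rule mt)
  \<comment> \<open>Heads may reach cell \<open>poly p (length x)\<close> itself, and counting cell
    0 a block needs one letter more.\<close>
  let ?B = "\<lambda>x. Suc (poly p (length x))"
  have sp: "snd (snd (run M x t) ! i) < ?B x" if "i < num_tapes M" for x t i
  proof -
    have "snd (run M x t) ! i \<in> set (snd (run M x t))"
      using good_run[OF M, of x t] that by (simp add: good_config_def)
    then show ?thesis using space[of x t] by (auto simp: split_beta less_Suc_eq_le)
  qed
  let ?f = "\<lambda>x. enc_lcl (tiling.tiling_lcl K (?B x) (\<lambda>j. initial (word_cells x j)) rule)"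
  have "?f x \<in> constant_time_lcls c" if x: "x \<in> L" for x
  proof -
    obtain t where "fst (run M x t) = 1" using dec[of x] x by auto
    then obtain N where
      "\<forall>w. (\<forall>v. w v < K) \<longrightarrow> \<not> tiling.valid_word (?B x) (\<lambda>j. initial (word_cells x j)) rule w N"
      using accepting_no_valid_word[of x "?B x", OF sp] by blast
    then show ?thesis
      using K_ge_2 by (intro tiling.constant_time_tiling_lcl[where N = N]) auto
  qed
  moreover have "?f x \<in> linear_time_lcls c" if x: "x \<notin> L" for x
  proof -
    obtain s where s: "halted (run M x s)" "fst (run M x s) \<noteq> 1" using dec[of x] x by auto
    \<comment> \<open>Two halted configurations of one run coincide, so acceptance at any time
      contradicts the other halting state at time \<open>s\<close>.\<close>
    have "fst (run M x t) \<noteq> 1" for t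
    proof
      assume t: "fst (run M x t) = 1"
      then have "halted (run M x t)" by (simp add: halted_def)
      then have "run M x t = run M x s"
        using run_halted[of M x t s] run_halted[OF s(1), of t] by (simp add: add.commute)
      then show False using s(2) t by simp
    qed
    from rejecting_valid_word[of x "?B x", OF sp this] obtain w where w: "\<forall>v. w v < K"
      "\<forall>a<K. \<forall>N. tiling.valid_word (?B x) (\<lambda>j. initial (word_cells x j)) rule (w(0 := a)) N"
      by blast
    then show ?thesis using tiling.linear_time_tiling_lcl[OF assms K_ge_2, of w] by simp
  qed
  ultimately show "\<exists>f. poly_time_computable f \<and>
      (\<forall>x. (x \<in> L \<longrightarrow> f x \<in> constant_time_lcls c) \<and> (x \<notin> L \<longrightarrow> f x \<in> linear_time_lcls c))"
    using poly_time_computable_tiling_lcl by blast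
qed

end
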